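(* Let $n\ge1$ and $0\le i\le n-1$. The set $\{c(T,\sigma,\tau_{T,\sigma}):(T,\sigma)\in\mathsf{Lyn}^2_{n,i}\}$, indexed by the bicolored Lyndon trees with leaf label set $[n]$ and $i$ red internal nodes, is the set of ascent-free maximal chains of the interval $[\hat 0,[n]^i]$ of the weighted partition poset $\Pi_n^w$ with respect to the edge labeling $\lambda$ defined in the context.
   Context: Poset. Let $[n]=\{1,\dots,n\}$. A weighted partition of $[n]$ is a set $\{B_1^{v_1},\dots,B_t^{v_t}\}$ where $\{B_1,\dots,B_t\}$ is a partition of $[n]$ and $v_i\in\{0,1,\dots,|B_i|-1\}$ (the weight of $B_i$). The poset $\Pi_n^w$ is the set of weighted partitions of $[n]$ ordered by: $\{A_1^{w_1},\dots,A_s^{w_s}\}\le\{B_1^{v_1},\dots,B_t^{v_t}\}$ iff $\{A_j\}$ refines $\{B_k\}$ and whenever $B_k=A_{i_1}\cup\cdots\cup A_{i_l}$, then $v_k-(w_{i_1}+\cdots+w_{i_l})\in\{0,\dots,l-1\}$. Its minimum is $\hat 0=\{\{1\}^0,\dots,\{n\}^0\}$ and its maximal elements are $[n]^i:=\{[n]^i\}$, $0\le i\le n-1$. Labeling. For $a\in[n]$ let $\Gamma_a=\{(a,b)^u:a<b\le n+1,\ u\in\{0,1\}\}$ with $(a,b)^u\le(a,c)^v$ iff $b\le c$ and $u\le v$; let $\Lambda_n=\Gamma_1\oplus\cdots\oplus\Gamma_n$ be the ordinal sum (elements of $\Gamma_a$ lie below those of $\Gamma_{a'}$ for $a<a'$).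 If $x\lessdot y$ in $\Pi_n^w$, then $y$ is obtained from $x$ by merging two blocks $A,B$ with $\min A<\min B$ and weights $w_A,w_B$ into a block $A\cup B$ of weight $u+w_A+w_B$, $u\in\{0,1\}$; set $\lambda(x\lessdot y)=(\min A,\min B)^u\in\Lambda_n$. A maximal chain $x_0\lessdot\cdots\lessdot x_t$ of an interval is ascent-free if $\lambda(x_{j},x_{j+1})\not<\lambda(x_{j+1},x_{j+2})$ in $\Lambda_n$ for all $0\le j\le t-2$. Trees. A bicolored binary tree is a complete plane binary tree (every internal node has a left child and a right child) with each internal node colored red or blue. $\mathcal{BT}_{n,i}$ is the set of pairs $(T,\sigma)$ with $T$ a bicolored binary tree with $n$ leaves and $i$ red internal nodes and $\sigma\in\mathfrak S_n$, the $j$th leaf from left to right being labeled $\sigma(j)$. Such a tree is normalized if the leftmost leaf of each subtree (rooted at any node) has the smallest label in that subtree. $L(x),R(x)$ are the left and right children of an internal node $x$; the valency $v(x)$ of a node $x$ is the smallest leaf label of the subtree rooted at $x$. An internal node $x$ is a Lyndon node if $v(R(L(x)))>v(R(x))$; the condition is regarded as satisfied when $L(x)$ is a leaf. A bicolored Lyndon tree is a normalized tree such that every internal node $x$ that is not a Lyndon node is colored blue and its left child is colored red. $\mathsf{Lyn}^2_{n,i}$ is the set of bicolored Lyndon trees in $\mathcal{BT}_{n,i}$. Chains. Put $u(\text{blue})=0$, $u(\text{red})=1$; to $u$-merge two blocks $A^a,B^b$ means to replace them by $(A\cup B)^{a+b+u}$. Let $v_1,\dots,v_{n-1}$ be the internal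 nodes of $T$ in postorder (left subtree, then right subtree, then root, recursively). A permutation $\tau\in\mathfrak S_{n-1}$ induces a linear extension of $T$ if in the list $v_{\tau(1)},\dots,v_{\tau(n-1)}$ each node precedes its parent. For such $\tau$, $c(T,\sigma,\tau)$ is the maximal chain of $[\hat 0,[n]^i]$ starting at $\hat 0$ whose rank $k$ element is obtained from its rank $k-1$ element by $u(\mathrm{col})$-merging the blocks whose underlying sets are the leaf label sets of the left and right subtrees of $v_{\tau(k)}$, where col is the color of $v_{\tau(k)}$. There is a unique linear extension of the internal nodes of $(T,\sigma)$ along which the valencies weakly decrease; $\tau_{T,\sigma}$ is the permutation inducing it. *)

theory Defs
  imports Complex_Main "HOL-Library.Disjoint_Sets" "HOL-Library.Tree"
    "HOL-Combinatorics.Permutations"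
begin

section \<open>The poset of weighted partitions\<close>

text \<open>A weighted block \<open>B\<^sup>v\<close> is the pair \<open>(B, v)\<close>.\<close>

type_synonym wpart = "(nat set \<times> nat) set"

definition blocks :: "wpart \<Rightarrow> nat set set" where
  "blocks x = fst ` x"

definition weighted_partitions :: "nat \<Rightarrow> wpart set" where
  "weighted_partitions n =
     {x. partition_on {1..n} (blocks x) \<and> inj_on fst x \<and>
         (\<forall>(B, v) \<in> x. v \<in> {0..card B - 1})}"

definition wp_le :: "nat \<Rightarrow> wpart \<Rightarrow> wpart \<Rightarrow> bool" where
  "wp_le n x y \<longleftrightarrow>
     x \<in> weighted_partitions n \<and> y \<in> weighted_partitions n \<and>
     refines {1..n} (blocks x) (blocks y) \<and>
     (\<forall>(B, v) \<in> y. let S = {p \<in> x. fst p \<subseteq> B} in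
        int v - (\<Sum>p\<in>S. int (snd p)) \<in> {0..int (card S) - 1})"

definition wp_less :: "nat \<Rightarrow> wpart \<Rightarrow> wpart \<Rightarrow> bool" where
  "wp_less n x y \<longleftrightarrow> wp_le n x y \<and> x \<noteq> y"

definition wp_covers :: "nat \<Rightarrow> wpart \<Rightarrow> wpart \<Rightarrow> bool" where
  "wp_covers n x y \<longleftrightarrow>
     wp_less n x y \<and> \<not> (\<exists>z. wp_less n x z \<and> wp_less n z y)"

definition wp_bot :: "nat \<Rightarrow> wpart" where
  "wp_bot n = (\<lambda>j. ({j}, 0)) ` {1..n}"

definition wp_top :: "nat \<Rightarrow> nat \<Rightarrow> wpart" where
  "wp_top n i = {({1..n}, i)}"

text \<open>A maximal chain \<open>x\<^sub>0 \<lessdot> \<dots> \<lessdot> x\<^sub>t\<close> of an interval is represented by the list of its elements.\<close>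

definition max_chains :: "nat \<Rightarrow> wpart \<Rightarrow> wpart \<Rightarrow> wpart list set" where
  "max_chains n x y =
     {c. c \<noteq> [] \<and> hd c = x \<and> last c = y \<and> successively (wp_covers n) c}"

definition block_weight :: "wpart \<Rightarrow> nat set \<Rightarrow> nat" where
  "block_weight x A = (THE w. (A, w) \<in> x)"

definition merge_blocks :: "nat \<Rightarrow> nat set \<Rightarrow> nat set \<Rightarrow> wpart \<Rightarrow> wpart" where
  "merge_blocks u A B x =
     {p \<in> x. fst p \<noteq> A \<and> fst p \<noteq> B} \<union>
     {(A \<union> B, block_weight x A + block_weight x B + u)}"


section \<open>The edge labeling\<close>

text \<open>The label \<open>(a, b)\<^sup>u\<close> is the triple \<open>(a, b, u)\<close>.\<close>

type_synonym label = "nat \<times> nat \<times> nat"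

definition Gamma :: "nat \<Rightarrow> nat \<Rightarrow> label set" where
  "Gamma n a = {(a, b, u) | b u. a < b \<and> b \<le> n + 1 \<and> u \<in> {0, 1}}"

definition Gamma_le :: "nat \<Rightarrow> nat \<Rightarrow> label \<Rightarrow> label \<Rightarrow> bool" where
  "Gamma_le n a p q \<longleftrightarrow> p \<in> Gamma n a \<and> q \<in> Gamma n a \<and>
     fst (snd p) \<le> fst (snd q) \<and> snd (snd p) \<le> snd (snd q)"

definition Lambda_le :: "nat \<Rightarrow> label \<Rightarrow> label \<Rightarrow> bool" where
  "Lambda_le n p q \<longleftrightarrow>
     (\<exists>a\<in>{1..n}. Gamma_le n a p q) \<or>
     (\<exists>a\<in>{1..n}. \<exists>a'\<in>{1..n}. a < a' \<and> p \<in> Gamma n a \<and> q \<in> Gamma n a')"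

definition Lambda_less :: "nat \<Rightarrow> label \<Rightarrow> label \<Rightarrow> bool" where
  "Lambda_less n p q \<longleftrightarrow> Lambda_le n p q \<and> p \<noteq> q"

text \<open>Only meaningful when \<open>y\<close> covers \<open>x\<close>; then \<open>A\<close>, \<open>B\<close> and \<open>u\<close> are uniquely determined.\<close>

definition edge_label :: "wpart \<Rightarrow> wpart \<Rightarrow> label" where
  "edge_label x y =
     (THE l. \<exists>A B u. A \<in> blocks x \<and> B \<in> blocks x \<and> Min A < Min B \<and> u \<in> {0, 1} \<and>
        y = merge_blocks u A B x \<and> l = (Min A, Min B, u))"

definition ascent_free :: "nat \<Rightarrow> wpart list \<Rightarrow> bool" where
  "ascent_free n c \<longleftrightarrow>
     (\<forall>j. j + 2 < length c \<longrightarrow>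
        \<not> Lambda_less n (edge_label (c ! j) (c ! (j + 1)))
                        (edge_label (c ! (j + 1)) (c ! (j + 2))))"


section \<open>Bicolored binary trees\<close>

datatype color = Red | Blue

primrec color_weight :: "color \<Rightarrow> nat" where
  "color_weight Blue = 0"
| "color_weight Red = 1"

text \<open>
  In \<^typ>\<open>color tree\<close> every internal node \<^term>\<open>Node l c r\<close> has two children and a color \<open>c\<close>,
  and the leaves carry no data; \<^term>\<open>size1 T\<close> is the number of leaves.
\<close>

definition BT :: "nat \<Rightarrow> nat \<Rightarrow> (color tree \<times> (nat \<Rightarrow> nat)) set" where
  "BT n i = {(T, \<sigma>). size1 T = n \<and> count_list (inorder T) Red = i \<and> \<sigma> permutes {1..n}}"

text \<open>
  A pair \<open>(T, \<sigma>)\<close> is turned into a leaf-labeled tree by writing \<open>\<sigma> j\<close> on the \<open>j\<close>-th leaf.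
  If the leaf labels are distinct, different nodes are the roots of different subtrees, and so
  we identify a node with the subtree rooted at it.
\<close>

datatype ltree =
    LLeaf nat
  | LNode (left: ltree) (root_color: color) (right: ltree)

primrec label_leaves :: "color tree \<Rightarrow> (nat \<Rightarrow> nat) \<Rightarrow> ltree" where
  "label_leaves Leaf \<sigma> = LLeaf (\<sigma> 1)"
| "label_leaves (Node l c r) \<sigma> =
     LNode (label_leaves l \<sigma>) c (label_leaves r (\<lambda>j. \<sigma> (size1 l + j)))"

primrec leaf_labels :: "ltree \<Rightarrow> nat set" where
  "leaf_labels (LLeaf a) = {a}"
| "leaf_labels (LNode l c r) = leaf_labels l \<union> leaf_labels r"

primrec leftmost_leaf :: "ltree \<Rightarrow> nat" where
  "leftmost_leaf (LLeaf a) = a"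
| "leftmost_leaf (LNode l c r) = leftmost_leaf l"

primrec subtrees :: "ltree \<Rightarrow> ltree set" where
  "subtrees (LLeaf a) = {LLeaf a}"
| "subtrees (LNode l c r) = {LNode l c r} \<union> subtrees l \<union> subtrees r"

primrec postorder_nodes :: "ltree \<Rightarrow> ltree list" where
  "postorder_nodes (LLeaf a) = []"
| "postorder_nodes (LNode l c r) = postorder_nodes l @ postorder_nodes r @ [LNode l c r]"

definition valency :: "ltree \<Rightarrow> nat" where
  "valency t = Min (leaf_labels t)"

definition normalized :: "ltree \<Rightarrow> bool" where
  "normalized t \<longleftrightarrow> (\<forall>s \<in> subtrees t. leftmost_leaf s = valency s)"

fun lyndon_node :: "ltree \<Rightarrow> bool" where
  "lyndon_node (LNode (LNode l c r) d s) \<longleftrightarrow> valency r > valency s"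
| "lyndon_node (LNode (LLeaf a) d s) \<longleftrightarrow> True"
| "lyndon_node (LLeaf a) \<longleftrightarrow> True"

text \<open>The left child of a node that is not a Lyndon node is internal, so it has a color.\<close>

definition bicolored_lyndon :: "ltree \<Rightarrow> bool" where
  "bicolored_lyndon t \<longleftrightarrow> normalized t \<and>
     (\<forall>x \<in> set (postorder_nodes t). \<not> lyndon_node x \<longrightarrow>
        root_color x = Blue \<and> root_color (left x) = Red)"

definition Lyn2 :: "nat \<Rightarrow> nat \<Rightarrow> (color tree \<times> (nat \<Rightarrow> nat)) set" where
  "Lyn2 n i = {(T, \<sigma>) \<in> BT n i. bicolored_lyndon (label_leaves T \<sigma>)}"


section \<open>The chains of a tree\<close>

text \<open>The internal nodes are numbered from \<open>1\<close>.\<close>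

definition internal_node :: "color tree \<Rightarrow> (nat \<Rightarrow> nat) \<Rightarrow> nat \<Rightarrow> ltree" where
  "internal_node T \<sigma> k = postorder_nodes (label_leaves T \<sigma>) ! (k - 1)"

definition is_child :: "ltree \<Rightarrow> ltree \<Rightarrow> bool" where
  "is_child x y \<longleftrightarrow> (\<exists>l c r. y = LNode l c r \<and> (x = l \<or> x = r))"

definition induces_linext :: "color tree \<Rightarrow> (nat \<Rightarrow> nat) \<Rightarrow> (nat \<Rightarrow> nat) \<Rightarrow> bool" where
  "induces_linext T \<sigma> \<tau> \<longleftrightarrow> \<tau> permutes {1..size T} \<and>
     (\<forall>j \<in> {1..size T}. \<forall>k \<in> {1..size T}.
        is_child (internal_node T \<sigma> (\<tau> j)) (internal_node T \<sigma> (\<tau> k)) \<longrightarrow> j < k)"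

definition tau :: "color tree \<Rightarrow> (nat \<Rightarrow> nat) \<Rightarrow> nat \<Rightarrow> nat" where
  "tau T \<sigma> = (THE \<tau>. induces_linext T \<sigma> \<tau> \<and>
     (\<forall>j \<in> {1..size T}. \<forall>k \<in> {1..size T}. j < k \<longrightarrow>
        valency (internal_node T \<sigma> (\<tau> j)) \<ge> valency (internal_node T \<sigma> (\<tau> k))))"

definition merge_at :: "ltree \<Rightarrow> wpart \<Rightarrow> wpart" where
  "merge_at x =
     merge_blocks (color_weight (root_color x)) (leaf_labels (left x)) (leaf_labels (right x))"

primrec chain_elem :: "color tree \<Rightarrow> (nat \<Rightarrow> nat) \<Rightarrow> (nat \<Rightarrow> nat) \<Rightarrow> nat \<Rightarrow> wpart" where
  "chain_elem T \<sigma> \<tau> 0 = wp_bot (size1 T)"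
| "chain_elem T \<sigma> \<tau> (Suc k) =
     merge_at (internal_node T \<sigma> (\<tau> (Suc k))) (chain_elem T \<sigma> \<tau> k)"

definition tree_chain :: "color tree \<Rightarrow> (nat \<Rightarrow> nat) \<Rightarrow> (nat \<Rightarrow> nat) \<Rightarrow> wpart list" where
  "tree_chain T \<sigma> \<tau> = map (chain_elem T \<sigma> \<tau>) [0..<size1 T]"

end

theory Submission
  imports Defs "HOL-Library.Product_Lexorder"
begin

text \<open>
  A covering relation merges two blocks, so a maximal chain from the bottom element is a sequence of
  merges, and recording which blocks were merged builds a normalized colored tree whose internal
  nodes are listed in the order of the merges, a linear extension of the tree. The label of a merge
  is the valency of the node, the valency of its right child and its color. If the chain is
  ascent-free, then the valencies decrease weakly along it. Since nodes of equal valency form a path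
  of left children, this determines the linear extension, and two consecutive merges of equal
  valency are exactly a node and its left child; there the absence of an ascent is the Lyndon
  condition.
\<close>

section \<open>Merging blocks in the weighted partition poset\<close>

text \<open>In the ordinal sum, labels with different first entries are always comparable, so a step
  without an ascent cannot raise the valency. Labels with equal first entries are compared in a
  product order: there an ascent is avoided iff the second entry drops or the color changes from red
  to blue. (The second entries cannot agree, being valencies of disjoint subtrees.) These are the
  two alternatives in the definition of a bicolored Lyndon tree. The obstacle is one of encoding:
  \<open>tau\<close> is a description ranging over permutations of postorder positions, while chains
  are lists of partitions. Both are compared with a third object, the list of internal nodes in
  merge order. \<open>builds\<close> links such lists to chains, \<open>node_order\<close> links
  permutations to such lists. For lists of nodes, being a linear extension with weakly decreasing
  valencies is the same as being strictly sorted by a linearly ordered key, and this yields both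
  existence and uniqueness of \<open>tau\<close>.\<close>

lemma weighted_partitionsD:
  assumes "x \<in> weighted_partitions n"
  shows "finite x" "inj_on fst x" "\<Union>(fst ` x) = {1..n}"
    "\<And>p. p \<in> x \<Longrightarrow> fst p \<noteq> {} \<and> finite (fst p) \<and> fst p \<subseteq> {1..n} \<and> snd p \<le> card (fst p) - 1"
    "\<And>p q. p \<in> x \<Longrightarrow> q \<in> x \<Longrightarrow> p \<noteq> q \<Longrightarrow> fst p \<inter> fst q = {}"
proof -
  have part: "partition_on {1..n} (fst ` x)" and inj: "inj_on fst x"
    and w: "\<And>p. p \<in> x \<Longrightarrow> snd p \<le> card (fst p) - 1"
    using assms unfolding weighted_partitions_def blocks_def by auto
  show inj': "inj_on fst x" by (fact inj)
  show un: "\<Union>(fst ` x) = {1..n}" using partition_onD1[OF part] by simp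
  have "finite (fst ` x)" using un by (intro finite_UnionD) auto
  then show "finite x" using inj finite_imageD by blast
  show "fst p \<noteq> {} \<and> finite (fst p) \<and> fst p \<subseteq> {1..n} \<and> snd p \<le> card (fst p) - 1"
    if "p \<in> x" for p
  proof -
    have "fst p \<subseteq> {1..n}" using un that by blast
    moreover have "fst p \<noteq> {}" using partition_onD3[OF part] that by force
    ultimately show ?thesis using w[OF that] finite_subset by blast
  qed
  show "fst p \<inter> fst q = {}" if "p \<in> x" "q \<in> x" "p \<noteq> q" for p q
  proof -
    have "fst p \<noteq> fst q" using inj that by (auto dest: inj_onD)
    then show ?thesis
      using partition_onD2[OF part] that unfolding pairwise_def disjnt_def by blast
  qed
qed

lemma weighted_partitionsI:
  assumes "\<Union>(fst ` x) = {1..n}" "\<And>p. p \<in> x \<Longrightarrow> fst p \<noteq> {} \<and> snd p \<le> card (fst p) - 1"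
    "\<And>p q. p \<in> x \<Longrightarrow> q \<in> x \<Longrightarrow> p \<noteq> q \<Longrightarrow> fst p \<inter> fst q = {}"
  shows "x \<in> weighted_partitions n"
proof -
  have "partition_on {1..n} (fst ` x)"
    using assms by (intro partition_onI) (force simp: disjnt_def)+
  moreover have "inj_on fst x"
    using assms(2,3) by (metis inj_onI inf.idem)
  ultimately show ?thesis
    using assms(2) by (auto simp: weighted_partitions_def blocks_def)
qed

lemma wp_bot_in_weighted_partitions: "wp_bot n \<in> weighted_partitions n"
  by (rule weighted_partitionsI) (auto simp: wp_bot_def)

lemma inj_on_fst_unique: "\<lbrakk>inj_on fst x; (A, a) \<in> x; (A, b) \<in> x\<rbrakk> \<Longrightarrow> a = b"
  using inj_onD[of fst x "(A, a)" "(A, b)"] by simp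

lemma block_weight_eq: "\<lbrakk>inj_on fst x; (A, w) \<in> x\<rbrakk> \<Longrightarrow> block_weight x A = w"
  unfolding block_weight_def by (rule the_equality) (auto intro: inj_on_fst_unique)

lemma merge_blocks_eq:
  assumes "inj_on fst x" "(A, a) \<in> x" "(B, b) \<in> x"
  shows "merge_blocks u A B x = insert (A \<union> B, a + b + u) (x - {(A, a), (B, b)})"
proof -
  have "{p \<in> x. fst p \<noteq> A \<and> fst p \<noteq> B} = x - {(A, a), (B, b)}"
    using inj_on_fst_unique[OF assms(1)] assms(2,3) by (auto 0 0)
  then show ?thesis
    unfolding merge_blocks_def block_weight_eq[OF assms(1,2)] block_weight_eq[OF assms(1,3)] by simp
qed

text \<open>Blocks are nonempty and pairwise disjoint, so a block containing \<open>A\<close> is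
  \<open>A\<close> itself, which cannot contain \<open>B\<close>. Hence the block created by a merge
  is new; block counts, weight sums and the recovery of \<open>u\<close> all rely on this.\<close>

lemma union_not_a_block:
  assumes x: "x \<in> weighted_partitions n" and A: "(A, a) \<in> x" and B: "(B, b) \<in> x"
    and "A \<noteq> B"
  shows "(A \<union> B, w) \<notin> x"
proof
  note D = weighted_partitionsD[OF x]
  assume AB: "(A \<union> B, w) \<in> x"
  have "A \<inter> B = {}" "A \<noteq> {}" "B \<noteq> {}"
    using D(5)[OF A B] D(4)[OF A] D(4)[OF B] assms(4) by simp_all
  moreover from this have "(A, a) = (A \<union> B, w)" using D(5)[OF A AB] by (metis Int_absorb2 Un_upper1 fst_conv)
  ultimately show False by blast
qed

lemma merge_blocks_in_weighted_partitions:
  assumes x: "x \<in> weighted_partitions n" and A: "(A, a) \<in> x" and B: "(B, b) \<in> x"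
    and "A \<noteq> B" "u \<le> 1"
  shows "merge_blocks u A B x \<in> weighted_partitions n"
proof -
  note D = weighted_partitionsD[OF x]
  have ne: "(A, a) \<noteq> (B, b)" using assms by auto
  have dis: "A \<inter> B = {}" using D(5)[OF A B ne] by simp
  have "card (A \<union> B) = card A + card B" using D(4)[OF A] D(4)[OF B] dis by (simp add: card_Un_disjoint)
  moreover have "card A > 0" "card B > 0" using D(4)[OF A] D(4)[OF B] by (auto simp: card_gt_0_iff)
  \<comment> \<open>The bounds \<open>card A - 1\<close> and \<open>card B - 1\<close> leave one
    unit of slack in \<open>card A + card B - 1\<close>, which \<open>u\<close> may fill. Positive
    cardinalities keep the subtractions from truncating.\<close>
  ultimately have w: "a + b + u \<le> card (A \<union> B) - 1"
    using D(4)[OF A] D(4)[OF B] assms(5) by auto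
  define R where "R = x - {(A, a), (B, b)}"
  have Rx: "p \<in> x" if "p \<in> R" for p using that by (simp add: R_def)
  have disR: "(A \<union> B) \<inter> fst q = {}" if "q \<in> R" for q
    using D(5)[OF A, of q] D(5)[OF B, of q] that by (auto simp: R_def)
  show ?thesis unfolding merge_blocks_eq[OF D(2) A B] R_def[symmetric]
  proof (rule weighted_partitionsI)
    have "x = insert (A, a) (insert (B, b) R)" using A B by (auto simp: R_def)
    then have "\<Union>(fst ` x) = A \<union> (B \<union> \<Union>(fst ` R))" by simp
    then show "\<Union> (fst ` insert (A \<union> B, a + b + u) R) = {1..n}"
      using D(3) by (simp add: Un_assoc)
    show "fst p \<noteq> {} \<and> snd p \<le> card (fst p) - 1"
      if "p \<in> insert (A \<union> B, a + b + u) R" for p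
    proof (cases "p \<in> R")
      case True
      then show ?thesis using D(4)[OF Rx] by simp
    next
      case False
      then show ?thesis using that w D(4)[OF A] by simp
    qed
    show "fst p \<inter> fst q = {}"
      if pq: "p \<in> insert (A \<union> B, a + b + u) R" "q \<in> insert (A \<union> B, a + b + u) R" "p \<noteq> q" for p q
    proof -
      consider "p = (A \<union> B, a + b + u)" "q \<in> R" | "q = (A \<union> B, a + b + u)" "p \<in> R"
        | "p \<in> R" "q \<in> R"
        using pq by blast
      then show ?thesis
      proof cases
        case 1
        then show ?thesis using disR[of q] by simp
      next
        case 2
        then show ?thesis using disR[of p] by (simp add: Int_commute)
      next
        case 3
        then show ?thesis using D(5)[OF Rx Rx pq(3)] by simp
      qed
    qed
  qed
qed

lemma blocks_below_self:
  assumes x: "x \<in> weighted_partitions n" and q: "q \<in> x"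
  shows "{p \<in> x. fst p \<subseteq> fst q} = {q}"
  using weighted_partitionsD(4)[OF x] weighted_partitionsD(5)[OF x _ q] q by blast

section \<open>Refinement, block count and covering relations\<close>

lemma wp_leI:
  assumes "x \<in> weighted_partitions n" "y \<in> weighted_partitions n"
    "\<And>p. p \<in> x \<Longrightarrow> \<exists>q\<in>y. fst p \<subseteq> fst q"
    "\<And>q. q \<in> y \<Longrightarrow> int (snd q) - (\<Sum>p | p \<in> x \<and> fst p \<subseteq> fst q. int (snd p)) \<in>
       {0..int (card {p \<in> x. fst p \<subseteq> fst q}) - 1}"
  shows "wp_le n x y"
  using assms unfolding wp_le_def refines_def Let_def
  by (auto simp: weighted_partitions_def blocks_def)

lemma wp_leD:
  assumes "wp_le n x y"
  shows "x \<in> weighted_partitions n" "y \<in> weighted_partitions n"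
    "\<And>p. p \<in> x \<Longrightarrow> \<exists>q\<in>y. fst p \<subseteq> fst q"
    "\<And>q. q \<in> y \<Longrightarrow> int (snd q) - (\<Sum>p | p \<in> x \<and> fst p \<subseteq> fst q. int (snd p)) \<in>
       {0..int (card {p \<in> x. fst p \<subseteq> fst q}) - 1}"
  using assms unfolding wp_le_def refines_def Let_def
  by (auto simp: blocks_def)

text \<open>If every block of \<open>y\<close> contained a single block of \<open>x\<close>, that
  block would fill it, and the excess weight would be confined to \<open>{0..0}\<close>; blocks and
  weights would agree, so \<open>x = y\<close>.\<close>

lemma wp_less_ex_split_block:
  assumes "wp_less n x y"
  obtains q where "q \<in> y" "2 \<le> card {p \<in> x. fst p \<subseteq> fst q}"
proof -
  have le: "wp_le n x y" and ne: "x \<noteq> y" using assms by (auto simp: wp_less_def)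
  note L = wp_leD[OF le]
  note X = weighted_partitionsD[OF L(1)] and Y = weighted_partitionsD[OF L(2)]
  show ?thesis
  proof (rule ccontr)
    assume "\<not> thesis"
    then have small: "\<not> 2 \<le> card {p \<in> x. fst p \<subseteq> fst q}" if "q \<in> y" for q
      using that \<open>\<And>q. \<lbrakk>q \<in> y; _\<rbrakk> \<Longrightarrow> thesis\<close> by blast
    have yx: "q \<in> x" if q: "q \<in> y" for q
    proof -
      \<comment> \<open>The interval that contains the excess is nonempty, which excludes the count
        0.\<close>
      have "card {p \<in> x. fst p \<subseteq> fst q} = 1" using L(4)[OF q] small[OF q] by auto
      then obtain p where p: "{p \<in> x. fst p \<subseteq> fst q} = {p}" by (metis card_1_singletonE)
      have "fst q \<subseteq> fst p"
      proof
        fix e assume e: "e \<in> fst q"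
        then have "e \<in> \<Union>(fst ` x)" using Y(4)[OF q] X(3) by blast
        then obtain p' where p': "p' \<in> x" "e \<in> fst p'" by blast
        obtain q' where q': "q' \<in> y" "fst p' \<subseteq> fst q'" using L(3) p' by blast
        then have "q' = q" using Y(5)[OF q'(1) q] e p' by blast
        then have "p' = p" using p p' q' by blast
        then show "e \<in> fst p" using p' by simp
      qed
      then have "fst p = fst q" using p by blast
      moreover have "snd p = snd q" using L(4)[OF q] unfolding p by simp
      ultimately have "p = q" by (simp add: prod_eq_iff)
      then show ?thesis using p by blast
    qed
    moreover have "p \<in> y" if p: "p \<in> x" for p
    proof -
      obtain q where q: "q \<in> y" "fst p \<subseteq> fst q" using L(3) p by blast
      then have "q = p" using X(4)[OF p] X(5)[OF p yx[OF q(1)]] by blast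
      then show ?thesis using q by simp
    qed
    ultimately show False using ne by blast
  qed
qed

text \<open>The block count acts as a rank: each block of \<open>y\<close> contains a block of
  \<open>x\<close>, some block contains two, and different blocks of \<open>y\<close> contain
  different ones.\<close>

lemma wp_less_card:
  assumes "wp_less n x y"
  shows "card y < card x"
proof -
  have le: "wp_le n x y" using assms by (auto simp: wp_less_def)
  note L = wp_leD[OF le]
  note X = weighted_partitionsD[OF L(1)] and Y = weighted_partitionsD[OF L(2)]
  let ?S = "\<lambda>q. {p \<in> x. fst p \<subseteq> fst q}"
  have pos: "1 \<le> card (?S q)" if "q \<in> y" for q using L(4)[OF that] by auto
  obtain q0 where q0: "q0 \<in> y" "2 \<le> card (?S q0)" using wp_less_ex_split_block[OF assms] .
  have "card y = (\<Sum>q\<in>y. 1)" by simp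
  also have "\<dots> < (\<Sum>q\<in>y. card (?S q))"
    using Y(1) pos q0 by (intro sum_strict_mono_ex1) (auto intro!: bexI[of _ q0])
  also have "\<dots> = card (\<Union>q\<in>y. ?S q)"
  proof (rule card_UN_disjoint[symmetric])
    show "\<forall>i\<in>y. \<forall>j\<in>y. i \<noteq> j \<longrightarrow> ?S i \<inter> ?S j = {}"
    proof (intro ballI impI equals0I)
      fix i j p assume "i \<in> y" "j \<in> y" "i \<noteq> j" "p \<in> ?S i \<inter> ?S j"
      then show False using Y(5)[of i j] X(4)[of p] by blast
    qed
  qed (use Y(1) X(1) in auto)
  also have "\<dots> \<le> card x" using X(1) by (intro card_mono) auto
  finally show ?thesis .
qed

lemma wp_le_merge_blocks:
  assumes x: "x \<in> weighted_partitions n" and A: "(A, a) \<in> x" and B: "(B, b) \<in> x"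
    and "A \<noteq> B" "u \<le> 1"
  shows "wp_le n x (merge_blocks u A B x)"
proof (rule wp_leI[OF x merge_blocks_in_weighted_partitions[OF assms]])
  note D = weighted_partitionsD[OF x]
  note eq = merge_blocks_eq[OF D(2) A B, of u]
  show "\<exists>q\<in>merge_blocks u A B x. fst p \<subseteq> fst q" if "p \<in> x" for p
    unfolding eq using that by (cases "p \<in> {(A, a), (B, b)}") auto
  show "int (snd q) - (\<Sum>p | p \<in> x \<and> fst p \<subseteq> fst q. int (snd p)) \<in>
       {0..int (card {p \<in> x. fst p \<subseteq> fst q}) - 1}" if "q \<in> merge_blocks u A B x" for q
  proof (cases "q = (A \<union> B, a + b + u)")
    case True
    have "p = (A, a) \<or> p = (B, b)" if p: "p \<in> x" "fst p \<subseteq> A \<union> B" for p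
      using D(5)[OF p(1) A] D(5)[OF p(1) B] D(4)[OF p(1)] p(2) by auto
    then have "{p \<in> x. fst p \<subseteq> fst q} = {(A, a), (B, b)}"
      using A B True by auto
    then show ?thesis using True assms(4,5) by simp
  next
    case False
    then have "q \<in> x" using that unfolding eq by auto
    then show ?thesis using blocks_below_self[OF x \<open>q \<in> x\<close>] by simp
  qed
qed

lemma card_merge_blocks:
  assumes x: "x \<in> weighted_partitions n" and A: "(A, a) \<in> x" and B: "(B, b) \<in> x"
    and "A \<noteq> B"
  shows "Suc (card (merge_blocks u A B x)) = card x"
proof -
  note D = weighted_partitionsD[OF x]
  have "(A \<union> B, a + b + u) \<notin> x - {(A, a), (B, b)}"
    using union_not_a_block[OF assms] by blast
  moreover have "card (x - {(A, a), (B, b)}) = card x - 2"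
    using D(1) A B assms(4) by (subst card_Diff_subset) auto
  moreover have "card {(A, a), (B, b)} \<le> card x"
    using D(1) A B by (intro card_mono) auto
  ultimately show ?thesis
    unfolding merge_blocks_eq[OF D(2) A B] using D(1) assms(4) by auto
qed

text \<open>A merge lowers the block count by exactly one, and every strict relation lowers it by at
  least one, so nothing fits in between.\<close>

lemma wp_covers_merge_blocks:
  assumes x: "x \<in> weighted_partitions n" and A: "(A, a) \<in> x" and B: "(B, b) \<in> x"
    and "A \<noteq> B" "u \<le> 1"
  shows "wp_covers n x (merge_blocks u A B x)"
proof -
  have c: "Suc (card (merge_blocks u A B x)) = card x"
    by (rule card_merge_blocks[OF assms(1-4)])
  then have "merge_blocks u A B x \<noteq> x" by auto
  then show ?thesis
    unfolding wp_covers_def using wp_le_merge_blocks[OF assms] c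
    by (auto simp: wp_less_def[of n x "merge_blocks u A B x"] dest!: wp_less_card)
qed

text \<open>
  Inside a block of \<open>y\<close> that splits, at least one merge stays below \<open>y\<close>: the excess weight of
  the block decides whether the merge may (and then should) use \<open>u = 1\<close>.
\<close>

lemma wp_less_ex_merge_blocks:
  assumes "wp_less n x y"
  obtains A a B b u where "(A, a) \<in> x" "(B, b) \<in> x" "Min A < Min B" "u \<le> 1"
    "wp_le n (merge_blocks u A B x) y"
proof -
  have le: "wp_le n x y" using assms by (auto simp: wp_less_def)
  note L = wp_leD[OF le]
  note X = weighted_partitionsD[OF L(1)] and Y = weighted_partitionsD[OF L(2)]
  let ?S = "\<lambda>q. {p \<in> x. fst p \<subseteq> fst q}"
  obtain q0 where q0: "q0 \<in> y" "2 \<le> card (?S q0)" using wp_less_ex_split_block[OF assms] .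
  have "finite (?S q0)" using X(1) by simp
  then have "\<not> (\<forall>p\<in>?S q0. \<forall>p'\<in>?S q0. p = p')"
    using card_le_Suc0_iff_eq q0(2) by fastforce
  then obtain p p' where p: "p \<in> ?S q0" "p' \<in> ?S q0" "p \<noteq> p'" by blast
  have "Min (fst p) \<noteq> Min (fst p')"
  proof -
    have "p \<in> x" "p' \<in> x" using p by auto
    then have "Min (fst p) \<in> fst p" "Min (fst p') \<in> fst p'" using X(4) Min_in by auto
    then show ?thesis using X(5)[OF \<open>p \<in> x\<close> \<open>p' \<in> x\<close> p(3)] by auto
  qed
  then consider "Min (fst p) < Min (fst p')" | "Min (fst p') < Min (fst p)" by linarith
  then have "\<exists>A a B b. (A, a) \<in> ?S q0 \<and> (B, b) \<in> ?S q0 \<and> Min A < Min B"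
  proof cases
    case 1
    then show ?thesis
      using p by (intro exI[of _ "fst p"] exI[of _ "snd p"] exI[of _ "fst p'"] exI[of _ "snd p'"]) simp
  next
    case 2
    then show ?thesis
      using p by (intro exI[of _ "fst p'"] exI[of _ "snd p'"] exI[of _ "fst p"] exI[of _ "snd p"]) simp
  qed
  then obtain A a B b where AB: "(A, a) \<in> ?S q0" "(B, b) \<in> ?S q0" "Min A < Min B" by blast
  then have A: "(A, a) \<in> x" and B: "(B, b) \<in> x" and "A \<noteq> B" by auto
  define s where "s = int (snd q0) - (\<Sum>p\<in>?S q0. int (snd p))"
  \<comment> \<open>With \<open>u = 0\<close> the largest admissible excess would violate the bound
    for one block fewer; with \<open>u = 1\<close> an excess of 0 would become negative.\<close>
  define u where "u = (if s \<ge> 1 then 1 else (0::nat))"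
  have s: "s \<in> {0..int (card (?S q0)) - 1}" using L(4)[OF q0(1)] by (simp add: s_def)
  have u: "u \<le> 1" by (simp add: u_def)
  let ?z = "merge_blocks u A B x"
  note eq = merge_blocks_eq[OF X(2) A B, of u]
  have "wp_le n ?z y"
  proof (rule wp_leI[OF merge_blocks_in_weighted_partitions[OF L(1) A B \<open>A \<noteq> B\<close> u] L(2)])
    show "\<exists>q\<in>y. fst p \<subseteq> fst q" if "p \<in> ?z" for p
    proof (cases "p \<in> x")
      case True
      then show ?thesis using L(3) by blast
    next
      case False
      then show ?thesis using that AB q0(1) unfolding eq by auto
    qed
    show "int (snd q) - (\<Sum>p | p \<in> ?z \<and> fst p \<subseteq> fst q. int (snd p)) \<in>
       {0..int (card {p \<in> ?z. fst p \<subseteq> fst q}) - 1}" if q: "q \<in> y" for q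
    proof (cases "q = q0")
      case False
      then have "\<not> A \<subseteq> fst q" "\<not> B \<subseteq> fst q"
        using Y(5)[OF q q0(1)] AB X(4)[OF A] X(4)[OF B] by auto
      then have "{p. p \<in> ?z \<and> fst p \<subseteq> fst q} = ?S q" unfolding eq by auto
      then show ?thesis using L(4)[OF q] by simp
    next
      case True
      have S: "{p. p \<in> ?z \<and> fst p \<subseteq> fst q} = insert (A \<union> B, a + b + u) (?S q0 - {(A, a), (B, b)})"
        using AB True unfolding eq by auto
      have fin: "finite (?S q0)" using X(1) by simp
      have notin: "(A \<union> B, a + b + u) \<notin> ?S q0 - {(A, a), (B, b)}"
        using union_not_a_block[OF L(1) A B \<open>A \<noteq> B\<close>] by blast
      have "card (?S q0 - {(A, a), (B, b)}) = card (?S q0) - 2"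
        using fin AB \<open>A \<noteq> B\<close> by (subst card_Diff_subset) auto
      then have c: "card {p. p \<in> ?z \<and> fst p \<subseteq> fst q} = card (?S q0) - 1"
        unfolding S using notin fin q0(2) by simp
      have "(\<Sum>p\<in>?S q0 - {(A, a), (B, b)}. int (snd p)) =
          (\<Sum>p\<in>?S q0. int (snd p)) - (\<Sum>p\<in>{(A, a), (B, b)}. int (snd p))"
        using fin AB by (intro sum_diff) auto
      then have "(\<Sum>p | p \<in> ?z \<and> fst p \<subseteq> fst q. int (snd p)) = (\<Sum>p\<in>?S q0. int (snd p)) + int u"
        unfolding S using notin fin \<open>A \<noteq> B\<close> by simp
      then have "int (snd q) - (\<Sum>p | p \<in> ?z \<and> fst p \<subseteq> fst q. int (snd p)) = s - int u"
        using True by (simp add: s_def)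
      then show ?thesis unfolding c using s q0(2) by (auto simp: u_def)
    qed
  qed
  then show ?thesis using that A B AB(3) u by blast
qed

lemma wp_covers_ex_merge_blocks:
  assumes "wp_covers n x y"
  obtains A a B b u where "(A, a) \<in> x" "(B, b) \<in> x" "Min A < Min B" "u \<le> 1"
    "y = merge_blocks u A B x"
proof -
  have less: "wp_less n x y" using assms by (simp add: wp_covers_def)
  then have x: "x \<in> weighted_partitions n" using wp_leD(1) by (auto simp: wp_less_def)
  obtain A a B b u where m: "(A, a) \<in> x" "(B, b) \<in> x" "Min A < Min B" "u \<le> 1"
    "wp_le n (merge_blocks u A B x) y" using wp_less_ex_merge_blocks[OF less] .
  then have "A \<noteq> B" by auto
  then have "wp_less n x (merge_blocks u A B x)"
    using wp_covers_merge_blocks[OF x m(1,2) _ m(4)] by (simp add: wp_covers_def)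
  then have "y = merge_blocks u A B x"
    using assms m(5) by (auto simp: wp_covers_def wp_less_def)
  then show ?thesis using that m by blast
qed

section \<open>Edge labels of merges\<close>

text \<open>Recovers the merged pair from the two partitions, which is what makes the description in
  \<open>edge_label\<close> well defined.\<close>

lemma blocks_diff_merge_blocks:
  assumes x: "x \<in> weighted_partitions n" and A: "(A, a) \<in> x" and B: "(B, b) \<in> x"
    and "A \<noteq> B"
  shows "blocks x - blocks (merge_blocks u A B x) = {A, B}"
proof -
  note D = weighted_partitionsD[OF x]
  have dis: "A \<inter> B = {}" "A \<noteq> {}" "B \<noteq> {}"
    using D(5)[OF A B] D(4)[OF A] D(4)[OF B] assms(4) by auto
  then have "A \<union> B \<noteq> A" "A \<union> B \<noteq> B" by auto
  moreover have "{A, B} \<subseteq> fst ` x" using imageI[OF A, of fst] imageI[OF B, of fst] by simp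
  moreover have "fst ` (x - {(A, a), (B, b)}) = fst ` x - {A, B}"
    using inj_on_image_set_diff[OF D(2), of x "{(A, a), (B, b)}"] A B by simp
  ultimately show ?thesis
    unfolding merge_blocks_eq[OF D(2) A B] blocks_def by auto
qed

lemma edge_label_merge_blocks:
  assumes x: "x \<in> weighted_partitions n" and A: "(A, a) \<in> x" and B: "(B, b) \<in> x"
    and less: "Min A < Min B" and u: "u \<le> 1"
  shows "edge_label x (merge_blocks u A B x) = (Min A, Min B, u)"
  unfolding edge_label_def
proof (rule the_equality)
  note D = weighted_partitionsD[OF x]
  show "\<exists>A' B' u'. A' \<in> blocks x \<and> B' \<in> blocks x \<and> Min A' < Min B' \<and> u' \<in> {0, 1} \<and>
     merge_blocks u A B x = merge_blocks u' A' B' x \<and> (Min A, Min B, u) = (Min A', Min B', u')"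
    using assms by (intro exI[of _ A] exI[of _ B] exI[of _ u]) (force simp: blocks_def)
  fix l
  assume "\<exists>A' B' u'. A' \<in> blocks x \<and> B' \<in> blocks x \<and> Min A' < Min B' \<and> u' \<in> {0, 1} \<and>
     merge_blocks u A B x = merge_blocks u' A' B' x \<and> l = (Min A', Min B', u')"
  then obtain A' a' B' b' u' where *: "(A', a') \<in> x" "(B', b') \<in> x" "Min A' < Min B'"
    "merge_blocks u A B x = merge_blocks u' A' B' x" "l = (Min A', Min B', u')"
    by (auto simp: blocks_def)
  have "A \<noteq> B" "A' \<noteq> B'" using less *(3) by auto
  then have "{A, B} = {A', B'}"
    using blocks_diff_merge_blocks[OF x A B] blocks_diff_merge_blocks[OF x *(1,2)] *(4) by metis
  then have eq: "A' = A" "B' = B" using less *(3) by (auto simp: doubleton_eq_iff)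
  then have "a' = a" "b' = b" using inj_on_fst_unique[OF D(2)] A B *(1,2) by auto
  \<comment> \<open>With the pair fixed, \<open>u\<close> is read off from the weight of the new
    block, since no old block has the underlying set \<open>A \<union> B\<close>.\<close>
  then have mem: "(A \<union> B, a + b + u') \<in> insert (A \<union> B, a + b + u) (x - {(A, a), (B, b)})"
    using *(4) merge_blocks_eq[OF D(2) A B] eq by auto
  have "(A \<union> B, a + b + u') \<notin> x - {(A, a), (B, b)}"
    using union_not_a_block[OF x A B \<open>A \<noteq> B\<close>] by blast
  with mem have "u' = u" by auto
  then show "l = (Min A, Min B, u)" using * eq by simp
qed

section \<open>Merge sequences and forests\<close>

primrec distinct_leaves :: "ltree \<Rightarrow> bool" where
  "distinct_leaves (LLeaf a) \<longleftrightarrow> True"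
| "distinct_leaves (LNode l c r) \<longleftrightarrow>
     distinct_leaves l \<and> distinct_leaves r \<and> leaf_labels l \<inter> leaf_labels r = {}"

text \<open>This is the weight of the block that the tree produces: singletons start with weight 0
  and each red merge contributes 1.\<close>

primrec num_red :: "ltree \<Rightarrow> nat" where
  "num_red (LLeaf a) = 0"
| "num_red (LNode l c r) = num_red l + num_red r + color_weight c"

lemma finite_leaf_labels [simp]: "finite (leaf_labels t)"
  by (induction t) auto

lemma leaf_labels_nonempty [simp]: "leaf_labels t \<noteq> {}"
  by (induction t) auto

lemma valency_in_leaf_labels [simp]: "valency t \<in> leaf_labels t"
  unfolding valency_def by (rule Min_in) auto

lemma valency_le: "a \<in> leaf_labels t \<Longrightarrow> valency t \<le> a"
  unfolding valency_def by simp

lemma valency_LNode [simp]: "valency (LNode l c r) = min (valency l) (valency r)"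
  unfolding valency_def by (simp add: Min_Un)

lemma valency_LLeaf [simp]: "valency (LLeaf a) = a"
  by (simp add: valency_def)

lemma normalized_LLeaf [simp]: "normalized (LLeaf a)"
  by (simp add: normalized_def)

lemma subtrees_refl [simp]: "t \<in> subtrees t"
  by (cases t) auto

lemma normalized_leftmost_leaf: "normalized t \<Longrightarrow> leftmost_leaf t = valency t"
  by (simp add: normalized_def)

text \<open>The leftmost leaf of the node is that of \<open>l\<close>, which is
  \<open>valency l\<close> when \<open>l\<close> is normalized; the condition at the root thus
  becomes a comparison of the two children.\<close>

lemma normalized_LNode [simp]:
  "normalized (LNode l c r) \<longleftrightarrow> normalized l \<and> normalized r \<and> valency l \<le> valency r"
proof -
  have "normalized (LNode l c r) \<longleftrightarrow> normalized l \<and> normalized r \<and>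
      leftmost_leaf l = min (valency l) (valency r)"
    by (auto simp: normalized_def)
  then show ?thesis using normalized_leftmost_leaf[of l] by (auto simp: min_def)
qed

lemma subtrees_trans: "s \<in> subtrees t \<Longrightarrow> t \<in> subtrees u \<Longrightarrow> s \<in> subtrees u"
  by (induction u) auto

lemma leaf_labels_subtree: "s \<in> subtrees t \<Longrightarrow> leaf_labels s \<subseteq> leaf_labels t"
  by (induction t) auto

lemma valency_subtree: "s \<in> subtrees t \<Longrightarrow> valency t \<le> valency s"
  using leaf_labels_subtree valency_in_leaf_labels valency_le by blast

lemma size_subtree: "s \<in> subtrees t \<Longrightarrow> s = t \<or> size s < size t"
  by (induction t) auto

lemma normalized_subtree: "s \<in> subtrees t \<Longrightarrow> normalized t \<Longrightarrow> normalized s"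
  by (induction t) auto

lemma distinct_leaves_subtree: "s \<in> subtrees t \<Longrightarrow> distinct_leaves t \<Longrightarrow> distinct_leaves s"
  by (induction t) auto

lemma set_postorder_nodes: "set (postorder_nodes t) = subtrees t - range LLeaf"
  by (induction t) auto

text \<open>Subtrees from different branches share no leaf, so overlapping leaf sets force
  nesting.\<close>

lemma subtrees_laminar:
  assumes "distinct_leaves t" "s \<in> subtrees t" "s' \<in> subtrees t"
  shows "s \<in> subtrees s' \<or> s' \<in> subtrees s \<or> leaf_labels s \<inter> leaf_labels s' = {}"
  using assms
proof (induction t)
  case (LNode l c r)
  have "leaf_labels s \<inter> leaf_labels s' = {}"
    if "s \<in> subtrees l" "s' \<in> subtrees r" for s s'
    using leaf_labels_subtree[OF that(1)] leaf_labels_subtree[OF that(2)] LNode.prems(1) by auto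
  then show ?case using LNode by (auto simp: Int_commute)
qed auto

text \<open>Distinct labels keep a subtree from occurring twice, which justifies identifying a node
  with its subtree.\<close>

lemma distinct_postorder_nodes: "distinct_leaves t \<Longrightarrow> distinct (postorder_nodes t)"
proof (induction t)
  case (LNode l c r)
  have "subtrees l \<inter> subtrees r = {}"
  proof (intro equals0I)
    fix s assume "s \<in> subtrees l \<inter> subtrees r"
    then have "leaf_labels s \<subseteq> leaf_labels l \<inter> leaf_labels r"
      using leaf_labels_subtree by blast
    then show False
      using LNode.prems by (metis distinct_leaves.simps(2) leaf_labels_nonempty subset_empty)
  qed
  moreover have "LNode l c r \<notin> subtrees l" "LNode l c r \<notin> subtrees r"
    using size_subtree by fastforce+
  ultimately show ?case using LNode by (auto simp: set_postorder_nodes)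
qed auto

lemma is_child_subtree: "is_child x y \<Longrightarrow> x \<in> subtrees y"
  by (auto simp: is_child_def)

lemma is_child_size: "is_child x y \<Longrightarrow> size x < size y"
  by (auto simp: is_child_def)

text \<open>Two parents of \<open>x\<close> share its leaves, hence are nested. The inner one, if
  different, lies below a child of the outer one: below \<open>x\<close> it would be smaller than
  its own child, below the sibling of \<open>x\<close> it would miss the leaves of
  \<open>x\<close>.\<close>

lemma parent_unique:
  assumes "distinct_leaves t" "y \<in> subtrees t" "y' \<in> subtrees t" "is_child x y" "is_child x y'"
  shows "y = y'"
proof -
  have *: "y = y'" if "y \<in> subtrees y'" "y' \<in> subtrees t" "is_child x y" "is_child x y'" for y y'
  proof (rule ccontr)
    assume "y \<noteq> y'"
    obtain l c r where y': "y' = LNode l c r" "x = l \<or> x = r" using \<open>is_child x y'\<close>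
      by (auto simp: is_child_def)
    have dis: "leaf_labels l \<inter> leaf_labels r = {}"
      using distinct_leaves_subtree[OF \<open>y' \<in> subtrees t\<close> assms(1)] y' by simp
    have sub: "leaf_labels x \<subseteq> leaf_labels y"
      using leaf_labels_subtree is_child_subtree \<open>is_child x y\<close> by blast
    have nx: "y \<notin> subtrees x"
      using size_subtree[of y x] is_child_size[OF \<open>is_child x y\<close>] by auto
    then have "y \<in> subtrees l \<and> x = r \<or> y \<in> subtrees r \<and> x = l"
      using \<open>y \<in> subtrees y'\<close> \<open>y \<noteq> y'\<close> y' by auto
    then have "leaf_labels y \<inter> leaf_labels x = {}"
      using leaf_labels_subtree[of y l] leaf_labels_subtree[of y r] dis by blast
    then show False using sub leaf_labels_nonempty[of x] by blast
  qed
  have "leaf_labels x \<subseteq> leaf_labels y \<inter> leaf_labels y'"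
    using leaf_labels_subtree is_child_subtree assms(4,5) by blast
  then have "leaf_labels y \<inter> leaf_labels y' \<noteq> {}" using leaf_labels_nonempty[of x] by blast
  then show ?thesis
    using subtrees_laminar[OF assms(1-3)] *[of y y'] *[of y' y] assms by auto
qed

section \<open>Forests grown by merges\<close>

text \<open>A tree in the forest is a current block together with the history of its merges. Placing
  the smaller valency on the left agrees with the convention of the labeling and keeps all trees
  normalized.\<close>

inductive builds :: "nat \<Rightarrow> ltree list \<Rightarrow> ltree set \<Rightarrow> bool" for n where
  Nil: "builds n [] (LLeaf ` {1..n})"
| snoc: "\<lbrakk>builds n xs F; l \<in> F; r \<in> F; valency l < valency r\<rbrakk> \<Longrightarrow>
    builds n (xs @ [LNode l c r]) (insert (LNode l c r) (F - {l, r}))"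

definition wp_of :: "ltree set \<Rightarrow> wpart" where
  "wp_of F = (\<lambda>t. (leaf_labels t, num_red t)) ` F"

definition merge_chain :: "nat \<Rightarrow> ltree list \<Rightarrow> wpart list" where
  "merge_chain n xs = map (\<lambda>k. fold merge_at (take k xs) (wp_bot n)) [0..<Suc (length xs)]"

definition node_label :: "ltree \<Rightarrow> label" where
  "node_label x = (valency (left x), valency (right x), color_weight (root_color x))"

definition children_first :: "ltree list \<Rightarrow> bool" where
  "children_first xs \<longleftrightarrow>
     (\<forall>j<length xs. \<forall>k<length xs. is_child (xs ! j) (xs ! k) \<longrightarrow> j < k)"

text \<open>One induction serves all parts because they support each other: disjoint trees give a
  new node distinct leaves, and knowing \<open>set xs\<close> shows that a new node is neither an
  old node nor a child of one.\<close>

lemma builds_forest: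
  assumes "builds n xs F"
  shows "\<And>t. t \<in> F \<Longrightarrow> normalized t \<and> distinct_leaves t"
    and "\<And>s t. s \<in> F \<Longrightarrow> t \<in> F \<Longrightarrow> s \<noteq> t \<Longrightarrow> leaf_labels s \<inter> leaf_labels t = {}"
    and "\<Union>(leaf_labels ` F) = {1..n}"
    and "set xs = (\<Union>t\<in>F. set (postorder_nodes t))"
    and "distinct xs"
    and "children_first xs"
proof -
  have "(\<forall>t\<in>F. normalized t \<and> distinct_leaves t) \<and>
    (\<forall>s\<in>F. \<forall>t\<in>F. s \<noteq> t \<longrightarrow> leaf_labels s \<inter> leaf_labels t = {}) \<and>
    \<Union>(leaf_labels ` F) = {1..n} \<and> set xs = (\<Union>t\<in>F. set (postorder_nodes t)) \<and>
    distinct xs \<and> children_first xs"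
    using assms
  proof induction
    case Nil
    then show ?case by (auto simp: children_first_def)
  next
    case (snoc xs F l r c)
    let ?x = "LNode l c r"
    let ?F = "insert ?x (F - {l, r})"
    have "l \<noteq> r" using snoc.hyps by auto
    have dis: "\<And>s t. s \<in> F \<Longrightarrow> t \<in> F \<Longrightarrow> s \<noteq> t \<Longrightarrow> leaf_labels s \<inter> leaf_labels t = {}"
      and un: "\<Union>(leaf_labels ` F) = {1..n}" and set: "set xs = (\<Union>t\<in>F. set (postorder_nodes t))"
      and cf: "children_first xs" and d: "distinct xs"
      and wf: "\<And>t. t \<in> F \<Longrightarrow> normalized t \<and> distinct_leaves t"
      using snoc.IH by auto
    have F: "F = insert l (insert r (F - {l, r}))" using snoc.hyps by blast
    have 1: "normalized t \<and> distinct_leaves t" if "t \<in> ?F" for t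
      using that wf snoc.hyps dis[OF snoc.hyps(2,3) \<open>l \<noteq> r\<close>] by auto
    have *: "leaf_labels ?x \<inter> leaf_labels t = {}" if "t \<in> F - {l, r}" for t
      using dis[of l t] dis[of r t] that snoc.hyps by auto
    have 2: "leaf_labels s \<inter> leaf_labels t = {}" if st: "s \<in> ?F" "t \<in> ?F" "s \<noteq> t" for s t
    proof -
      consider "s = ?x" "t \<in> F - {l, r}" | "t = ?x" "s \<in> F - {l, r}" | "s \<in> F" "t \<in> F"
        using st by (metis Diff_iff insert_iff)
      then show ?thesis
        by cases (use *[of s] *[of t] dis[of s t] \<open>s \<noteq> t\<close> in \<open>auto simp: Int_commute\<close>)
    qed
    have "\<Union>(leaf_labels ` F) = leaf_labels l \<union> (leaf_labels r \<union> \<Union>(leaf_labels ` (F - {l, r})))"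
      by (subst F) simp
    then have 3: "\<Union>(leaf_labels ` ?F) = {1..n}" using un by (simp add: Un_assoc)
    have "(\<Union>t\<in>F. set (postorder_nodes t)) = set (postorder_nodes l) \<union> (set (postorder_nodes r)
        \<union> (\<Union>t\<in>F - {l, r}. set (postorder_nodes t)))"
      by (subst F) simp
    then have 4: "set (xs @ [?x]) = (\<Union>t\<in>?F. set (postorder_nodes t))"
      using set by auto
    \<comment> \<open>If the new node lay inside an old one, some tree of the forest would contain
      leaves of both \<open>l\<close> and \<open>r\<close> and so would equal both.\<close>
    have notin: "\<not> is_child ?x y \<and> ?x \<noteq> y" if y: "y \<in> set xs" for y
    proof -
      have "?x \<notin> subtrees y"
      proof
        assume "?x \<in> subtrees y"
        moreover obtain t where t: "t \<in> F" "y \<in> subtrees t"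
          using y set by (auto simp: set_postorder_nodes)
        ultimately have "leaf_labels l \<subseteq> leaf_labels t" "leaf_labels r \<subseteq> leaf_labels t"
          using leaf_labels_subtree[OF subtrees_trans[of ?x y t]] by auto
        then have "l = t" "r = t"
          using dis[OF snoc.hyps(2) t(1)] dis[OF snoc.hyps(3) t(1)]
            leaf_labels_nonempty[of l] leaf_labels_nonempty[of r] by blast+
        then show False using \<open>l \<noteq> r\<close> by simp
      qed
      then show ?thesis using is_child_subtree by auto
    qed
    have 5: "distinct (xs @ [?x])" using d notin by auto
    have 6: "children_first (xs @ [?x])"
      unfolding children_first_def
    proof (intro allI impI)
      fix j k assume jk: "j < length (xs @ [?x])" "k < length (xs @ [?x])"
        and ch: "is_child ((xs @ [?x]) ! j) ((xs @ [?x]) ! k)"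
      show "j < k"
      proof (cases "j = length xs")
        case True
        then have "is_child ?x ((xs @ [?x]) ! k)" using ch by simp
        moreover have "(xs @ [?x]) ! k = ?x \<or> (xs @ [?x]) ! k \<in> set xs"
          using jk by (auto simp: nth_append)
        ultimately show ?thesis using notin is_child_size[of ?x ?x] by auto
      next
        case False
        then show ?thesis
          using jk ch cf by (cases "k = length xs") (auto simp: children_first_def nth_append)
      qed
    qed
    show ?case using 1 2 3 4 5 6 by blast
  qed
  note inv = this
  show "normalized t \<and> distinct_leaves t" if "t \<in> F" for t
    using inv that by simp
  show "leaf_labels s \<inter> leaf_labels t = {}" if "s \<in> F" "t \<in> F" "s \<noteq> t" for s t
    using inv that by simp
  show "\<Union>(leaf_labels ` F) = {1..n}" "set xs = (\<Union>t\<in>F. set (postorder_nodes t))"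
    "distinct xs" "children_first xs"
    using inv by simp_all
qed

section \<open>From forests to chains and back\<close>

lemma wp_of_leaves [simp]: "wp_of (LLeaf ` {Suc 0..n}) = wp_bot n"
  by (auto simp: wp_of_def wp_bot_def image_image)

lemma inj_on_leaf_labels:
  assumes "\<And>s t. s \<in> F \<Longrightarrow> t \<in> F \<Longrightarrow> s \<noteq> t \<Longrightarrow> leaf_labels s \<inter> leaf_labels t = {}"
  shows "inj_on leaf_labels F"
  using assms leaf_labels_nonempty by (metis inf.idem inj_onI)

text \<open>Disjoint leaf sets make the passage from trees to weighted blocks injective, so removing
  two trees removes exactly their two blocks.\<close>

lemma wp_of_merge:
  assumes dis: "\<And>s t. s \<in> F \<Longrightarrow> t \<in> F \<Longrightarrow> s \<noteq> t \<Longrightarrow> leaf_labels s \<inter> leaf_labels t = {}"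
    and "l \<in> F" "r \<in> F"
  shows "merge_at (LNode l c r) (wp_of F) = wp_of (insert (LNode l c r) (F - {l, r}))"
proof -
  let ?f = "\<lambda>t. (leaf_labels t, num_red t)"
  note inj = inj_on_leaf_labels[OF dis]
  then have inj': "inj_on ?f F" by (auto simp: inj_on_def)
  have "inj_on fst (wp_of F)" using inj by (auto simp: wp_of_def inj_on_def)
  moreover have "?f l \<in> wp_of F" "?f r \<in> wp_of F" using assms by (auto simp: wp_of_def)
  moreover have "?f ` (F - {l, r}) = ?f ` F - {?f l, ?f r}"
    using inj_on_image_set_diff[OF inj', of F "{l, r}"] assms by simp
  ultimately show ?thesis by (simp add: merge_at_def merge_blocks_eq) (simp add: wp_of_def)
qed

lemma builds_fold: "builds n xs F \<Longrightarrow> fold merge_at xs (wp_bot n) = wp_of F"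
proof (induction rule: builds.induct)
  case (snoc xs F l r c)
  then show ?case using wp_of_merge[OF builds_forest(2)[OF snoc.hyps(1)] snoc.hyps(2,3)] by simp
qed simp

lemma color_weight_le: "color_weight c \<le> 1"
  by (cases c) auto

lemma builds_step:
  assumes b: "builds n xs F" and x: "wp_of F \<in> weighted_partitions n"
    and lr: "l \<in> F" "r \<in> F" "valency l < valency r"
  shows "wp_covers n (wp_of F) (merge_at (LNode l c r) (wp_of F))"
    and "edge_label (wp_of F) (merge_at (LNode l c r) (wp_of F)) = node_label (LNode l c r)"
    and "merge_at (LNode l c r) (wp_of F) \<in> weighted_partitions n"
proof -
  have l: "(leaf_labels l, num_red l) \<in> wp_of F" and r: "(leaf_labels r, num_red r) \<in> wp_of F"
    using lr by (auto simp: wp_of_def)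
  have less: "Min (leaf_labels l) < Min (leaf_labels r)" using lr by (simp add: valency_def)
  then have ne: "leaf_labels l \<noteq> leaf_labels r" by auto
  show "wp_covers n (wp_of F) (merge_at (LNode l c r) (wp_of F))"
    using wp_covers_merge_blocks[OF x l r ne color_weight_le[of c]] by (simp add: merge_at_def)
  show "edge_label (wp_of F) (merge_at (LNode l c r) (wp_of F)) = node_label (LNode l c r)"
    using edge_label_merge_blocks[OF x l r less color_weight_le[of c]]
    by (simp add: merge_at_def node_label_def valency_def)
  show "merge_at (LNode l c r) (wp_of F) \<in> weighted_partitions n"
    using merge_blocks_in_weighted_partitions[OF x l r ne color_weight_le[of c]]
    by (simp add: merge_at_def)
qed

lemma builds_wp: "builds n xs F \<Longrightarrow> wp_of F \<in> weighted_partitions n"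
proof (induction rule: builds.induct)
  case (snoc xs F l r c)
  then show ?case
    using builds_step(3)[of n xs F l r c] wp_of_merge[OF builds_forest(2)[OF snoc.hyps(1)] snoc.hyps(2,3)]
    by simp
qed (simp add: wp_bot_in_weighted_partitions)

lemma length_merge_chain [simp]: "length (merge_chain n xs) = Suc (length xs)"
  by (simp add: merge_chain_def)

lemma nth_merge_chain:
  "k \<le> length xs \<Longrightarrow> merge_chain n xs ! k = fold merge_at (take k xs) (wp_bot n)"
  unfolding merge_chain_def by (subst nth_map) (auto simp del: upt_Suc)

lemma merge_chain_Nil: "merge_chain n [] = [wp_bot n]"
  by (simp add: merge_chain_def)

lemma merge_chain_snoc:
  "merge_chain n (xs @ [x]) = merge_chain n xs @ [fold merge_at (xs @ [x]) (wp_bot n)]"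
  by (rule nth_equalityI) (auto simp: nth_append nth_merge_chain less_Suc_eq_le)

lemma last_merge_chain: "last (merge_chain n xs) = fold merge_at xs (wp_bot n)"
  by (cases xs rule: rev_cases) (simp_all add: merge_chain_Nil merge_chain_snoc)

lemma hd_merge_chain: "hd (merge_chain n xs) = wp_bot n"
  using nth_merge_chain[of 0 xs n] by (simp add: hd_conv_nth flip: length_greater_0_conv)

lemma builds_successively: "builds n xs F \<Longrightarrow> successively (wp_covers n) (merge_chain n xs)"
proof (induction rule: builds.induct)
  case (snoc xs F l r c)
  then show ?case
    using builds_step(1)[OF snoc.hyps(1) builds_wp[OF snoc.hyps(1)] snoc.hyps(2-4), of c]
    by (simp add: merge_chain_snoc successively_append_iff last_merge_chain builds_fold)
qed (simp add: merge_chain_Nil)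

lemma builds_edge_label:
  "builds n xs F \<Longrightarrow> k < length xs \<Longrightarrow>
    edge_label (merge_chain n xs ! k) (merge_chain n xs ! Suc k) = node_label (xs ! k)"
proof (induction rule: builds.induct)
  case (snoc xs F l r c)
  show ?case
  proof (cases "k = length xs")
    case True
    then show ?thesis
      using builds_step(2)[OF snoc.hyps(1) builds_wp[OF snoc.hyps(1)] snoc.hyps(2-4), of c]
        builds_fold[OF snoc.hyps(1)]
      by (simp add: nth_merge_chain)
  next
    case False
    then show ?thesis using snoc by (simp add: merge_chain_snoc nth_append)
  qed
qed simp

lemma chain_ex_builds:
  assumes "c \<noteq> []" "hd c = wp_bot n" "successively (wp_covers n) c"
  shows "\<exists>xs F. builds n xs F \<and> c = merge_chain n xs"
  using assms
proof (induction c rule: rev_induct)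
  case (snoc y c)
  show ?case
  proof (cases "c = []")
    case True
    then show ?thesis
      using snoc.prems builds.Nil[of n] by (intro exI[of _ "[]"]) (auto simp: merge_chain_Nil)
  next
    case False
    then obtain xs F where b: "builds n xs F" and c: "c = merge_chain n xs"
      using snoc by (auto simp: successively_append_iff)
    have "wp_covers n (wp_of F) y"
      using snoc.prems False by (simp add: successively_append_iff c last_merge_chain builds_fold[OF b])
    then obtain A a B b' u where m: "(A, a) \<in> wp_of F" "(B, b') \<in> wp_of F" "Min A < Min B" "u \<le> 1"
      "y = merge_blocks u A B (wp_of F)"
      by (rule wp_covers_ex_merge_blocks)
    then obtain l r where lr: "l \<in> F" "r \<in> F" "A = leaf_labels l" "B = leaf_labels r"
      by (auto simp: wp_of_def)
    define col where "col = (if u = 1 then Red else Blue)"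
    have "u = color_weight col" using m(4) by (auto simp: col_def)
    then have "y = merge_at (LNode l col r) (wp_of F)" using m lr by (simp add: merge_at_def)
    moreover have "builds n (xs @ [LNode l col r]) (insert (LNode l col r) (F - {l, r}))"
      using b lr m(3) by (intro builds.snoc) (auto simp: valency_def)
    ultimately show ?thesis using builds_fold[OF b] c
      by (intro exI[of _ "xs @ [LNode l col r]"]) (auto simp: merge_chain_snoc)
  qed
qed simp

section \<open>Linear extensions by decreasing valency\<close>

lemma postorder_nodesE:
  assumes "x \<in> set (postorder_nodes t)"
  obtains l c r where "x = LNode l c r"
proof (cases x)
  case (LLeaf a)
  then show ?thesis using assms by (simp add: set_postorder_nodes)
qed (rule that)

lemma valency_neq: "leaf_labels s \<inter> leaf_labels t = {} \<Longrightarrow> valency s \<noteq> valency t"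
  by (metis IntI empty_iff valency_in_leaf_labels)

lemma normalized_valency_less:
  assumes "normalized (LNode l c r)" "distinct_leaves (LNode l c r)"
  shows "valency l < valency r"
proof -
  have "valency l \<noteq> valency r"
    using assms(2) by (intro valency_neq) simp
  then show ?thesis using assms(1) by simp
qed

lemma subtrees_leaves: "subtrees t \<inter> range LLeaf = LLeaf ` leaf_labels t"
proof (induction t)
  case (LNode l c r)
  have "subtrees (LNode l c r) \<inter> range LLeaf =
      (subtrees l \<inter> range LLeaf) \<union> (subtrees r \<inter> range LLeaf)"
    by auto
  then show ?case using LNode by (simp add: image_Un)
qed auto

lemma ex_parent: "s \<in> subtrees t \<Longrightarrow> s = t \<or> (\<exists>y \<in> set (postorder_nodes t). is_child s y)"
  by (induction t) (auto simp: is_child_def)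

text \<open>Formulated for lists of nodes instead of permutations of positions;
  \<open>induces_linext_iff\<close> translates between the two.\<close>

definition linear_extension :: "ltree \<Rightarrow> ltree list \<Rightarrow> bool" where
  "linear_extension t xs \<longleftrightarrow>
     distinct xs \<and> set xs = set (postorder_nodes t) \<and> children_first xs"

lemma builds_linear_extension: "builds n xs {t} \<Longrightarrow> linear_extension t xs"
  using builds_forest(4-6)[of n xs "{t}"] by (simp add: linear_extension_def)

text \<open>Converse of \<open>builds_linear_extension\<close>. When a node is reached, its children
  are roots of the current forest: they come earlier or are leaves, and no other node is their
  parent.\<close>

lemma linear_extension_builds:
  assumes wf: "normalized t" "distinct_leaves t" and lab: "leaf_labels t = {1..n}"
    and xs: "linear_extension t xs"
  shows "builds n xs {t}"
proof -
  \<comment> \<open>Once the nodes in a prefix \<open>X\<close> of the list are created, the roots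
    are the leaves and created nodes whose parent has not been created yet.\<close>
  define forest where "forest X =
    {s \<in> subtrees t. (s \<in> X \<or> s \<in> range LLeaf) \<and> (\<forall>y\<in>X. \<not> is_child s y)}" for X
  have d: "distinct xs" and set: "set xs = subtrees t - range LLeaf" and cf: "children_first xs"
    using xs by (auto simp: linear_extension_def set_postorder_nodes)
  have "builds n (take k xs) (forest (set (take k xs)))" if "k \<le> length xs" for k
    using that
  proof (induction k)
    case 0
    have "forest {} = subtrees t \<inter> range LLeaf" by (auto simp: forest_def)
    then have "forest {} = LLeaf ` {1..n}" using subtrees_leaves[of t] lab by simp
    then show ?case using builds.Nil[of n] by simp
  next
    case (Suc k)
    let ?x = "xs ! k" and ?X = "set (take k xs)"
    have k: "k < length xs" using Suc.prems by simp
    then have xset: "?x \<in> set xs" by simp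
    then obtain l c r where x: "?x = LNode l c r"
      using xs by (auto simp: linear_extension_def elim: postorder_nodesE)
    have xt: "?x \<in> subtrees t" using xset set by blast
    have child: "s \<in> forest ?X" if s: "is_child s ?x" for s
    proof -
      have st: "s \<in> subtrees t" using is_child_subtree[OF s] subtrees_trans xt by blast
      have "s \<in> ?X \<or> s \<in> range LLeaf"
      proof (cases "s \<in> range LLeaf")
        case False
        then have "s \<in> set xs" using st set by blast
        then obtain j where j: "j < length xs" "xs ! j = s" by (auto simp: in_set_conv_nth)
        then have "j < k" using cf k s by (auto simp: children_first_def)
        then show ?thesis using j by (auto simp: in_set_conv_nth)
      qed simp
      moreover have "\<not> is_child s y" if "y \<in> ?X" for y
      proof
        assume "is_child s y"
        moreover have "y \<in> subtrees t" using that set set_take_subset by fast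
        ultimately have "y = ?x" using parent_unique[OF wf(2) _ xt] s by blast
        then show False
          using that d k by (auto simp: in_set_conv_nth nth_eq_iff_index_eq)
      qed
      ultimately show ?thesis using st by (simp add: forest_def)
    qed
    have lr: "is_child l ?x" "is_child r ?x" unfolding x by (auto simp: is_child_def)
    have "normalized ?x" "distinct_leaves ?x"
      using normalized_subtree distinct_leaves_subtree xt wf by auto
    then have less: "valency l < valency r" unfolding x by (rule normalized_valency_less)
    have nochild: "\<not> is_child ?x y" if y: "y \<in> ?X" for y
    proof -
      obtain j where j: "j < k" "y = xs ! j" using y k by (auto simp: in_set_conv_nth)
      then show ?thesis using cf k unfolding children_first_def by (metis less_asym less_trans)
    qed
    have chx: "is_child s ?x \<longleftrightarrow> s = l \<or> s = r" for s unfolding x by (auto simp: is_child_def)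
    \<comment> \<open>The new node is a root because its parent comes later, and it absorbs exactly
      its own two children.\<close>
    have "forest (insert ?x ?X) = insert ?x (forest ?X - {l, r})"
      using xt nochild chx is_child_size[of ?x ?x] by (auto simp: forest_def)
    moreover have "builds n (take k xs @ [?x]) (insert ?x (forest ?X - {l, r}))"
      unfolding x using Suc k child[OF lr(1)] child[OF lr(2)] less by (intro builds.snoc) auto
    ultimately show ?case using k by (simp add: take_Suc_conv_app_nth)
  qed
  from this[of "length xs"] have "builds n xs (forest (set xs))" by simp
  moreover have "forest (set xs) = {t}"
  proof -
    have "\<not> is_child t y" if "y \<in> set xs" for y
      using that set size_subtree[of y t] is_child_size[of t y] by auto
    moreover have "t \<in> set xs \<or> t \<in> range LLeaf" using set subtrees_refl[of t] by blast
    ultimately have "t \<in> forest (set xs)" by (simp add: forest_def)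
    moreover have "s = t" if "s \<in> forest (set xs)" for s
      using that ex_parent[of s t] xs by (auto simp: forest_def linear_extension_def)
    ultimately show ?thesis by blast
  qed
  ultimately show ?thesis by simp
qed

text \<open>
  Nodes of equal valency in a normalized tree form a path of left children, so sorting by this key
  lists the nodes by decreasing valency and, among equal valencies, from the bottom up.
\<close>

definition node_key :: "ltree \<Rightarrow> int \<times> nat" where
  "node_key x = (- int (valency x), size x)"

abbreviation key_sorted :: "ltree list \<Rightarrow> bool" where
  "key_sorted \<equiv> sorted_wrt (\<lambda>x y. node_key x < node_key y)"

abbreviation valency_decreasing :: "ltree list \<Rightarrow> bool" where
  "valency_decreasing \<equiv> sorted_wrt (\<lambda>x y. valency y \<le> valency x)"

lemma node_key_less:
  "node_key x < node_key y \<longleftrightarrow> valency y < valency x \<or> valency x = valency y \<and> size x < size y"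
  by (auto simp: node_key_def)

text \<open>Both subtrees contain the leaf labeled by the common valency, so their leaf sets
  meet.\<close>

lemma equal_valency_comparable:
  assumes "distinct_leaves t" "x \<in> subtrees t" "y \<in> subtrees t" "valency x = valency y"
  shows "x \<in> subtrees y \<or> y \<in> subtrees x"
  using subtrees_laminar[OF assms(1-3)] assms(4) valency_in_leaf_labels[of x]
    valency_in_leaf_labels[of y] by auto

text \<open>\<open>children_first\<close> speaks of adjacent nodes only; the induction on the
  ancestor carries it along the path down to any descendant.\<close>

lemma descendants_first:
  assumes "linear_extension t xs" "j < length xs" "k < length xs" "xs ! j \<in> subtrees (xs ! k)"
    "xs ! j \<noteq> xs ! k"
  shows "j < k"
proof -
  have set: "set xs = subtrees t - range LLeaf" and cf: "children_first xs"
    using assms(1) by (auto simp: linear_extension_def set_postorder_nodes)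
  let ?s = "xs ! j"
  have s: "?s \<in> set xs" using assms(2) by simp
  have "j < k" if "k < length xs" "xs ! k = y" "?s \<in> subtrees y" "?s \<noteq> y" for y k
    using that
  proof (induction y arbitrary: k)
    case (LLeaf a)
    then show ?case by simp
  next
    case (LNode l c r)
    have step: "j < k" if m: "?s \<in> subtrees m" "is_child m (LNode l c r)"
      and IH: "\<And>k. k < length xs \<Longrightarrow> xs ! k = m \<Longrightarrow> ?s \<in> subtrees m \<Longrightarrow> ?s \<noteq> m \<Longrightarrow> j < k" for m
    proof -
      have "LNode l c r \<in> subtrees t" using LNode.prems(1,2) set nth_mem by fastforce
      then have "m \<in> subtrees t" using is_child_subtree[OF m(2)] subtrees_trans by blast
      \<comment> \<open>A leaf has no subtree but itself, whereas \<open>?s\<close> is an internal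
        node inside \<open>m\<close>.\<close>
      moreover have "m \<notin> range LLeaf" using m(1) s set by auto
      ultimately have "m \<in> set xs" using set by blast
      then obtain i where i: "i < length xs" "xs ! i = m" by (auto simp: in_set_conv_nth)
      then have "i < k" using cf LNode.prems(1,2) m(2) by (auto simp: children_first_def)
      moreover have "j \<le> i"
        using IH[OF i m(1)] i assms(1,2)
        by (cases "?s = m") (auto simp: linear_extension_def nth_eq_iff_index_eq)
      ultimately show ?thesis by simp
    qed
    show ?case
      using LNode step[of l] step[of r] by (auto simp: is_child_def)
  qed
  then show ?thesis using assms by blast
qed

text \<open>Nodes of equal valency are nested, and the linear extension lists the inner, smaller one
  first.\<close>

lemma linear_extension_key_sorted:
  assumes "distinct_leaves t" "linear_extension t xs" "valency_decreasing xs"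
  shows "key_sorted xs"
  unfolding sorted_wrt_iff_nth_less
proof (intro allI impI)
  fix j k assume jk: "j < k" "k < length xs"
  have le: "valency (xs ! k) \<le> valency (xs ! j)"
    using assms(3) jk by (auto simp: sorted_wrt_iff_nth_less)
  have ne: "xs ! j \<noteq> xs ! k"
    using assms(2) jk by (auto simp: linear_extension_def nth_eq_iff_index_eq)
  have mem: "xs ! j \<in> subtrees t" "xs ! k \<in> subtrees t"
    using assms(2) jk nth_mem[of j xs] nth_mem[of k xs]
    by (auto simp: linear_extension_def set_postorder_nodes)
  have "size (xs ! j) < size (xs ! k)" if "valency (xs ! j) = valency (xs ! k)"
  proof -
    have "xs ! k \<notin> subtrees (xs ! j)"
      using descendants_first[OF assms(2), of k j] jk ne by auto
    then show ?thesis
      using equal_valency_comparable[OF assms(1) mem that] size_subtree ne by blast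
  qed
  then show "node_key (xs ! j) < node_key (xs ! k)"
    using le by (auto simp: node_key_less)
qed

text \<open>Moving up never raises the valency and always raises the size, so the key order extends
  the tree order.\<close>

lemma is_child_key: "is_child x y \<Longrightarrow> node_key x < node_key y"
  using is_child_size[of x y] valency_subtree[OF is_child_subtree, of x y]
  by (auto simp: node_key_less)

lemma key_sorted_linear_extension:
  assumes "key_sorted xs" "set xs = set (postorder_nodes t)"
  shows "linear_extension t xs" "valency_decreasing xs"
proof -
  show "valency_decreasing xs"
    using assms(1) by (rule sorted_wrt_mono_rel[rotated]) (auto simp: node_key_less)
  have "sorted_wrt (<) (map node_key xs)" using assms(1) by (simp add: sorted_wrt_map)
  then have "distinct (map node_key xs)" using strict_sorted_iff by blast
  then have "distinct xs" by (simp add: distinct_map)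
  moreover have "children_first xs"
    unfolding children_first_def
  proof (intro allI impI)
    fix j k assume jk: "j < length xs" "k < length xs" "is_child (xs ! j) (xs ! k)"
    have "\<not> k < j"
      using is_child_key[OF jk(3)] assms(1) jk(1) less_asym unfolding sorted_wrt_iff_nth_less by blast
    moreover have "j \<noteq> k" using is_child_key[OF jk(3)] by auto
    ultimately show "j < k" by simp
  qed
  ultimately show "linear_extension t xs" using assms(2) by (simp add: linear_extension_def)
qed

lemma key_sorted_unique:
  assumes "key_sorted xs" "key_sorted ys" "set xs = set ys"
  shows "xs = ys"
proof -
  have *: "sorted_wrt (<) (map node_key xs)" "sorted_wrt (<) (map node_key ys)"
    using assms by (simp_all add: sorted_wrt_map)
  then have "map node_key xs = map node_key ys"
    using strict_sorted_equal assms(3) by (metis list.set_map)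
  moreover have "inj_on node_key (set xs)"
    using *(1) strict_sorted_iff by (metis distinct_map)
  ultimately show ?thesis using assms(3) by (auto intro: map_inj_on)
qed

text \<open>Nodes with equal keys are nested and of equal size, hence equal; so sorting by the key
  is strict.\<close>

lemma ex_key_sorted:
  assumes "distinct_leaves t"
  shows "\<exists>xs. key_sorted xs \<and> set xs = set (postorder_nodes t)"
proof -
  let ?xs = "sort_key node_key (postorder_nodes t)"
  have "inj_on node_key (set (postorder_nodes t))"
  proof (rule inj_onI)
    fix x y assume "x \<in> set (postorder_nodes t)" "y \<in> set (postorder_nodes t)" "node_key x = node_key y"
    then show "x = y"
      using equal_valency_comparable[OF assms, of x y] size_subtree[of x y] size_subtree[of y x]
      by (auto simp: node_key_def set_postorder_nodes)
  qed
  then have "distinct (map node_key ?xs)"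
    using distinct_postorder_nodes[OF assms] by (simp add: distinct_map)
  then have "sorted_wrt (<) (map node_key ?xs)" by (simp add: strict_sorted_iff)
  then show ?thesis by (intro exI[of _ ?xs]) (simp add: sorted_wrt_map)
qed

text \<open>The leaf labeled \<open>valency l\<close> lies in \<open>l\<close>, so no subtree of
  \<open>r\<close> contains it.\<close>

lemma equal_valency_in_left:
  assumes "distinct_leaves (LNode l c r)" "z \<in> subtrees (LNode l c r)" "z \<noteq> LNode l c r"
    "valency z = valency l"
  shows "z \<in> subtrees l"
proof -
  have "z \<notin> subtrees r"
    using assms(1,4) leaf_labels_subtree[of z r] valency_in_leaf_labels
    by (metis IntI distinct_leaves.simps(2) empty_iff subsetD)
  then show ?thesis using assms(2,3) by simp
qed

text \<open>An entry listed strictly between \<open>l\<close> and its parent would share their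
  valency and have a size strictly between theirs; it would then lie below the parent, hence inside
  \<open>l\<close>, and be too large for that.\<close>

lemma key_sorted_left_child:
  assumes wf: "normalized t" "distinct_leaves t"
    and xs: "key_sorted xs" "set xs = set (postorder_nodes t)"
    and k: "k < length xs" "xs ! k = LNode l c r" and l: "l \<notin> range LLeaf"
  obtains j where "k = Suc j" "xs ! j = l"
proof -
  have set: "set xs = subtrees t - range LLeaf" using xs by (simp add: set_postorder_nodes)
  let ?y = "LNode l c r"
  have yt: "?y \<in> subtrees t" using k set nth_mem by fastforce
  then have ywf: "normalized ?y" "distinct_leaves ?y"
    using normalized_subtree distinct_leaves_subtree wf by blast+
  have vy: "valency ?y = valency l" using ywf(1) by simp
  have "l \<in> subtrees t" using subtrees_trans[OF _ yt, of l] by simp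
  then have "l \<in> set xs" using l set by blast
  then obtain m where m: "m < length xs" "xs ! m = l" by (auto simp: in_set_conv_nth)
  have mono: "node_key (xs ! i) < node_key (xs ! j)" if "i < j" "j < length xs" for i j
    using that xs(1) by (auto simp: sorted_wrt_iff_nth_less)
  have ly: "node_key l < node_key ?y" by (rule is_child_key) (simp add: is_child_def)
  have "\<not> k < m"
  proof
    assume "k < m"
    then have "node_key ?y < node_key l" using mono[of k m] m k by simp
    then show False using ly by (rule less_asym)
  qed
  moreover have "k \<noteq> m" using ly m k by auto
  ultimately have "m < k" by simp
  have "Suc m = k"
  proof (rule ccontr)
    assume "Suc m \<noteq> k"
    then have "Suc m < k" using \<open>m < k\<close> by simp
    let ?z = "xs ! Suc m"
    have "?z \<in> set xs" using \<open>Suc m < k\<close> k by simp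
    then have zt: "?z \<in> subtrees t" using set by blast
    have "node_key l < node_key ?z" "node_key ?z < node_key ?y"
      using mono[of m "Suc m"] mono[of "Suc m" k] m k \<open>Suc m < k\<close> by auto
    then have z: "valency ?z = valency l" "size l < size ?z" "size ?z < size ?y"
      using vy unfolding node_key_less by auto
    then have "?z \<in> subtrees ?y"
      using equal_valency_comparable[OF wf(2) zt yt] vy size_subtree[of ?y ?z] by auto
    moreover have "?z \<noteq> ?y" using z(3) by force
    ultimately have "?z \<in> subtrees l" using equal_valency_in_left[OF ywf(2)] z(1) by blast
    then show False using size_subtree[of ?z l] z(2) by auto
  qed
  then show ?thesis using that m by blast
qed

text \<open>Converse of \<open>key_sorted_left_child\<close>: equal valency puts the earlier node
  inside the left subtree of the later one. The left child is therefore internal, and as direct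
  predecessor in the list it is the earlier node.\<close>

lemma key_sorted_equal_valency:
  assumes wf: "normalized t" "distinct_leaves t"
    and xs: "key_sorted xs" "set xs = set (postorder_nodes t)"
    and k: "Suc k < length xs" and v: "valency (xs ! k) = valency (xs ! Suc k)"
  shows "left (xs ! Suc k) = xs ! k"
proof -
  have set: "set xs = subtrees t - range LLeaf" using xs by (simp add: set_postorder_nodes)
  have mem: "xs ! k \<in> set xs" "xs ! Suc k \<in> set xs" using k by auto
  then obtain l c r where y: "xs ! Suc k = LNode l c r" using xs(2) by (metis postorder_nodesE)
  have "LNode l c r \<in> subtrees t" using mem(2) set unfolding y by blast
  then have wfy: "normalized (LNode l c r)" "distinct_leaves (LNode l c r)"
    using normalized_subtree distinct_leaves_subtree wf by blast+
  have "node_key (xs ! k) < node_key (xs ! Suc k)"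
    using xs(1) k by (auto simp: sorted_wrt_iff_nth_less)
  then have size: "size (xs ! k) < size (xs ! Suc k)" using v by (auto simp: node_key_less)
  have "xs ! k \<in> subtrees (xs ! Suc k)"
  proof -
    have "xs ! k \<in> subtrees t" "xs ! Suc k \<in> subtrees t" using mem set by blast+
    then show ?thesis
      using equal_valency_comparable[OF wf(2) _ _ v] size_subtree[of "xs ! Suc k" "xs ! k"] size
      by auto
  qed
  moreover have "xs ! k \<noteq> xs ! Suc k" using size by force
  moreover have "valency (xs ! k) = valency l" using v wfy(1) unfolding y by simp
  ultimately have "xs ! k \<in> subtrees l"
    using equal_valency_in_left[OF wfy(2)] unfolding y by blast
  moreover have "xs ! k \<notin> range LLeaf" using mem(1) set by blast
  ultimately have "l \<notin> range LLeaf" by auto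
  then obtain j where "Suc k = Suc j" "xs ! j = l"
    by (rule key_sorted_left_child[OF wf xs k y])
  then show ?thesis using y by simp
qed

section \<open>Ascents and the Lyndon condition\<close>

lemma Gamma_iff: "(a, b, u) \<in> Gamma n a' \<longleftrightarrow> a' = a \<and> a < b \<and> b \<le> n + 1 \<and> u \<in> {0, 1}"
  by (auto simp: Gamma_def)

text \<open>The label of a node lies in the \<open>Gamma\<close> indexed by its valency, so the
  ordinal sum compares valencies and the product order decides only ties.\<close>

lemma Lambda_less_node_label:
  assumes wf: "normalized t" "distinct_leaves t" and lab: "leaf_labels t = {1..n}"
    and "x \<in> set (postorder_nodes t)" "y \<in> set (postorder_nodes t)"
  shows "Lambda_less n (node_label x) (node_label y) \<longleftrightarrow> valency x < valency y \<or>
    valency x = valency y \<and> valency (right x) \<le> valency (right y) \<and>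
    color_weight (root_color x) \<le> color_weight (root_color y) \<and> node_label x \<noteq> node_label y"
proof -
  have *: "\<exists>l c r. x = LNode l c r \<and> valency x = valency l \<and> valency l < valency r \<and>
      valency r \<le> n + 1 \<and> 1 \<le> valency l \<and> valency l \<le> n \<and> color_weight c \<in> {0, 1}"
    if "x \<in> set (postorder_nodes t)" for x
  proof -
    have xt: "x \<in> subtrees t" "x \<notin> range LLeaf" using that by (auto simp: set_postorder_nodes)
    then obtain l c r where x: "x = LNode l c r" using \<open>x \<in> set (postorder_nodes t)\<close>
      by (metis postorder_nodesE)
    have "valency l < valency r"
      using normalized_valency_less normalized_subtree distinct_leaves_subtree xt wf unfolding x by blast
    moreover have "valency l \<in> {1..n}" "valency r \<in> {1..n}"
      using leaf_labels_subtree[OF xt(1)] valency_in_leaf_labels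
      unfolding lab x by (auto simp del: atLeastAtMost_iff)
    moreover have "color_weight c \<in> {0, 1}" by (cases c) auto
    ultimately show ?thesis unfolding x by auto
  qed
  obtain l c r where x: "x = LNode l c r" "valency x = valency l" "valency l < valency r"
      "valency r \<le> n + 1" "1 \<le> valency l" "valency l \<le> n" "color_weight c \<in> {0, 1}"
    using * assms(4) by blast
  obtain l' c' r' where y: "y = LNode l' c' r'" "valency y = valency l'" "valency l' < valency r'"
      "valency r' \<le> n + 1" "1 \<le> valency l'" "valency l' \<le> n" "color_weight c' \<in> {0, 1}"
    using * assms(5) by blast
  show ?thesis
    using x(2-) y(2-) unfolding x(1) y(1) Lambda_less_def Lambda_le_def Gamma_le_def node_label_def
    by (auto simp: Gamma_iff)
qed

text \<open>Weak decrease is transitive, so it can be tested on neighbors, and it makes the list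
  \<open>key_sorted\<close>. Then \<open>key_sorted_left_child\<close> leads from a non-Lyndon node
  to a pair of neighbors, and \<open>key_sorted_equal_valency\<close> leads from neighbors of equal
  valency to a node and its left child.\<close>

lemma ascent_free_merge_chain:
  assumes "builds n xs {t}"
  shows "ascent_free n (merge_chain n xs) \<longleftrightarrow> valency_decreasing xs \<and> bicolored_lyndon t"
proof -
  note B = builds_forest[OF assms]
  have wf: "normalized t" "distinct_leaves t" and lab: "leaf_labels t = {1..n}"
    using B(1,3) by auto
  have lin: "linear_extension t xs" using builds_linear_extension[OF assms] .
  then have set: "set xs = set (postorder_nodes t)" by (simp add: linear_extension_def)
  have af: "ascent_free n (merge_chain n xs) \<longleftrightarrow>
      (\<forall>j. Suc j < length xs \<longrightarrow> \<not> Lambda_less n (node_label (xs ! j)) (node_label (xs ! Suc j)))"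
    unfolding ascent_free_def using builds_edge_label[OF assms] by simp
  have less: "Lambda_less n (node_label (xs ! j)) (node_label (xs ! k)) \<longleftrightarrow>
    valency (xs ! j) < valency (xs ! k) \<or> valency (xs ! j) = valency (xs ! k) \<and>
    valency (right (xs ! j)) \<le> valency (right (xs ! k)) \<and>
    color_weight (root_color (xs ! j)) \<le> color_weight (root_color (xs ! k)) \<and>
    node_label (xs ! j) \<noteq> node_label (xs ! k)"
    if "j < length xs" "k < length xs" for j k
    using Lambda_less_node_label[OF wf lab, of "xs ! j" "xs ! k"] that set nth_mem by metis
  show ?thesis
  proof (intro iffI conjI)
    assume "ascent_free n (merge_chain n xs)"
    then have *: "\<not> Lambda_less n (node_label (xs ! j)) (node_label (xs ! Suc j))"
      if "Suc j < length xs" for j using that af by blast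
    have "transp (\<lambda>x y. valency y \<le> valency x)" by (auto intro!: transpI)
    moreover have "valency (xs ! Suc j) \<le> valency (xs ! j)" if "Suc j < length xs" for j
      using *[OF that] less[of j "Suc j"] that by simp
    ultimately show dec: "valency_decreasing xs" by (simp add: sorted_wrt_iff_nth_Suc_transp)
    then have ks: "key_sorted xs" using linear_extension_key_sorted wf(2) lin by blast
    show "bicolored_lyndon t"
      unfolding bicolored_lyndon_def
    proof (intro conjI ballI impI wf(1))
      fix y assume y: "y \<in> set (postorder_nodes t)" "\<not> lyndon_node y"
      then obtain l c r d s where yeq: "y = LNode (LNode l c r) d s" and le: "valency r \<le> valency s"
        by (cases y rule: lyndon_node.cases) auto
      obtain k where k: "k < length xs" "xs ! k = y" using y(1) set by (metis in_set_conv_nth)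
      then obtain j where j: "k = Suc j" "xs ! j = LNode l c r"
        using key_sorted_left_child[OF wf ks set, of k "LNode l c r" d s] yeq by auto
      have yt: "y \<in> subtrees t" using y by (simp add: set_postorder_nodes)
      have wfy: "normalized y" "distinct_leaves y"
        using normalized_subtree distinct_leaves_subtree yt wf by auto
      \<comment> \<open>As \<open>r\<close> and \<open>s\<close> are disjoint, \<open>le\<close> is
        strict and the labels differ; only a strict drop of the color weight can then prevent an
        ascent.\<close>
      have "valency r \<noteq> valency s"
        using wfy(2) unfolding yeq by (intro valency_neq) auto
      then have "color_weight d < color_weight c"
        using *[of j] less[of j k] k j wfy(1) le unfolding yeq by (auto simp: node_label_def)
      then show "root_color y = Blue" "root_color (left y) = Red"
        unfolding yeq by (cases c; cases d; simp)+
    qed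
  next
    assume A: "valency_decreasing xs \<and> bicolored_lyndon t"
    then have ks: "key_sorted xs" using linear_extension_key_sorted wf(2) lin by blast
    show "ascent_free n (merge_chain n xs)"
      unfolding af
    proof (intro allI impI)
      fix j assume j: "Suc j < length xs"
      show "\<not> Lambda_less n (node_label (xs ! j)) (node_label (xs ! Suc j))"
      proof (cases "valency (xs ! j) = valency (xs ! Suc j)")
        case False
        have "valency (xs ! Suc j) \<le> valency (xs ! j)"
          using A j by (auto simp: sorted_wrt_iff_nth_less)
        then show ?thesis using False less[of j "Suc j"] j by auto
      next
        case True
        have left: "left (xs ! Suc j) = xs ! j"
          by (rule key_sorted_equal_valency[OF wf ks set j True])
        have mem: "xs ! j \<in> set (postorder_nodes t)" "xs ! Suc j \<in> set (postorder_nodes t)"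
          using j set nth_mem Suc_lessD by metis+
        then obtain l c r where x: "xs ! j = LNode l c r"
          by (metis postorder_nodesE)
        obtain d s where y: "xs ! Suc j = LNode (LNode l c r) d s"
        proof -
          obtain l' d s where y': "xs ! Suc j = LNode l' d s"
            using mem(2) by (rule postorder_nodesE)
          then have "l' = LNode l c r" using left x by simp
          then show ?thesis using y' that by simp
        qed
        have "valency s < valency r \<or> c = Red \<and> d = Blue"
        proof -
          have "\<forall>x\<in>set (postorder_nodes t). \<not> lyndon_node x \<longrightarrow>
              root_color x = Blue \<and> root_color (left x) = Red"
            using A unfolding bicolored_lyndon_def by (elim conjE)
          from bspec[OF this mem(2)] show ?thesis unfolding y by auto
        qed
        then show ?thesis using less[of j "Suc j"] j unfolding x y by auto
      qed
    qed
  qed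
qed

section \<open>Trees with permuted leaf labels\<close>

text \<open>Leaf positions of a node: those of the left subtree, then those of the right subtree
  shifted by the number of left leaves.\<close>

lemma atLeastAtMost_add_split: "{1..m + k} = {1..m} \<union> (+) m ` {1..k}" for m k :: nat
proof -
  have "x \<in> (+) m ` {1..k}" if "m < x" "x \<le> m + k" for x
    using that by (intro image_eqI[of _ _ "x - m"]) auto
  then show ?thesis by (auto simp: not_le)
qed

lemma leaf_labels_label_leaves: "leaf_labels (label_leaves T \<sigma>) = \<sigma> ` {1..size1 T}"
proof (induction T arbitrary: \<sigma>)
  case (Node l c r)
  have "leaf_labels (label_leaves (Node l c r) \<sigma>) =
      \<sigma> ` {1..size1 l} \<union> (\<lambda>j. \<sigma> (size1 l + j)) ` {1..size1 r}"
    unfolding label_leaves.simps leaf_labels.simps Node ..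
  also have "\<dots> = \<sigma> ` ({1..size1 l} \<union> (+) (size1 l) ` {1..size1 r})"
    by (simp only: image_Un image_image)
  finally show ?case by (simp only: atLeastAtMost_add_split[symmetric] size1.simps)
qed simp

lemma distinct_leaves_label_leaves:
  "distinct_leaves (label_leaves T \<sigma>) \<longleftrightarrow> inj_on \<sigma> {1..size1 T}"
proof (induction T arbitrary: \<sigma>)
  case (Node l c r)
  let ?A = "{1..size1 l}" and ?B = "(+) (size1 l) ` {1..size1 r}"
  have "distinct_leaves (label_leaves (Node l c r) \<sigma>) \<longleftrightarrow> inj_on \<sigma> ?A \<and>
      inj_on (\<sigma> \<circ> (+) (size1 l)) {1..size1 r} \<and> \<sigma> ` ?A \<inter> \<sigma> ` ?B = {}"
    unfolding label_leaves.simps distinct_leaves.simps Node leaf_labels_label_leaves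
    by (simp only: comp_def image_image)
  also have "\<dots> \<longleftrightarrow> inj_on \<sigma> ?A \<and> inj_on \<sigma> ?B \<and> \<sigma> ` ?A \<inter> \<sigma> ` ?B = {}"
    by (simp only: comp_inj_on_iff[OF inj_on_add])
  also have "\<dots> \<longleftrightarrow> inj_on \<sigma> (?A \<union> ?B)"
  proof -
    have "?A - ?B = ?A" "?B - ?A = ?B" by auto
    then show ?thesis by (simp only: inj_on_Un)
  qed
  finally show ?case by (simp only: atLeastAtMost_add_split[symmetric] size1.simps)
qed simp

lemma num_red_label_leaves: "num_red (label_leaves T \<sigma>) = count_list (inorder T) Red"
proof (induction T arbitrary: \<sigma>)
  case (Node l c r)
  then show ?case by (cases c) auto
qed simp

lemma length_postorder_label_leaves: "length (postorder_nodes (label_leaves T \<sigma>)) = size T"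
  by (induction T arbitrary: \<sigma>) auto

lemma label_leaves_cong:
  "(\<And>j. j \<in> {1..size1 T} \<Longrightarrow> \<sigma> j = \<sigma>' j) \<Longrightarrow> label_leaves T \<sigma> = label_leaves T \<sigma>'"
proof (induction T arbitrary: \<sigma> \<sigma>')
  case (Node l c r)
  have "label_leaves l \<sigma> = label_leaves l \<sigma>'"
    using Node.prems by (intro Node.IH(1)) auto
  moreover have "label_leaves r (\<lambda>j. \<sigma> (size1 l + j)) = label_leaves r (\<lambda>j. \<sigma>' (size1 l + j))"
    using Node.prems by (intro Node.IH(2)) auto
  ultimately show ?case by simp
qed simp

lemma ex_label_leaves: "\<exists>T \<sigma>. label_leaves T \<sigma> = t"
proof (induction t)
  case (LLeaf a)
  show ?case by (rule exI[of _ Leaf], rule exI[of _ "\<lambda>_. a"]) simp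
next
  case (LNode l c r)
  then obtain Tl \<sigma>l Tr \<sigma>r where lr: "label_leaves Tl \<sigma>l = l" "label_leaves Tr \<sigma>r = r" by blast
  let ?\<sigma> = "\<lambda>j. if j \<le> size1 Tl then \<sigma>l j else \<sigma>r (j - size1 Tl)"
  have "label_leaves Tl ?\<sigma> = l" "label_leaves Tr (\<lambda>j. ?\<sigma> (size1 Tl + j)) = r"
    unfolding lr[symmetric] by (rule label_leaves_cong; simp)+
  then show ?case by (intro exI[of _ "Node Tl c Tr"] exI[of _ ?\<sigma>]) simp
qed

lemma ex_permutation_label_leaves:
  assumes "distinct_leaves t" "leaf_labels t = {1..n}"
  obtains T \<sigma> where "label_leaves T \<sigma> = t" "size1 T = n" "\<sigma> permutes {1..n}"
proof -
  obtain T \<sigma>0 where t: "label_leaves T \<sigma>0 = t" using ex_label_leaves by blast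
  \<comment> \<open>A permutation of \<open>{1..n}\<close> must be the identity outside, where
    \<open>\<sigma>0\<close> is arbitrary; the tree reads only positions inside.\<close>
  define \<sigma> where "\<sigma> j = (if j \<in> {1..n} then \<sigma>0 j else j)" for j
  have inj: "inj_on \<sigma>0 {1..size1 T}" and img: "\<sigma>0 ` {1..size1 T} = {1..n}"
    using assms distinct_leaves_label_leaves[of T \<sigma>0] leaf_labels_label_leaves[of T \<sigma>0] t by auto
  have n: "size1 T = n" using card_image[OF inj] img by simp
  have "bij_betw \<sigma>0 {1..n} {1..n}" using inj img n by (simp add: bij_betw_def)
  then have "bij_betw \<sigma> {1..n} {1..n}" by (rule bij_betw_cong[THEN iffD1, rotated]) (simp add: \<sigma>_def)
  then have "\<sigma> permutes {1..n}" by (rule bij_imp_permutes) (auto simp: \<sigma>_def)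
  moreover have "label_leaves T \<sigma> = t"
    unfolding t[symmetric] by (rule label_leaves_cong) (simp add: \<sigma>_def n)
  ultimately show ?thesis using that n by blast
qed

section \<open>The permutation \<open>tau\<close> as an order of nodes\<close>

text \<open>\<open>Suc\<close> mediates between list positions, counted from 0, and the arguments of
  \<tau>, counted from 1.\<close>

definition node_order :: "color tree \<Rightarrow> (nat \<Rightarrow> nat) \<Rightarrow> (nat \<Rightarrow> nat) \<Rightarrow> ltree list" where
  "node_order T \<sigma> \<tau> = map (\<lambda>j. internal_node T \<sigma> (\<tau> (Suc j))) [0..<size T]"

lemma length_node_order [simp]: "length (node_order T \<sigma> \<tau>) = size T"
  by (simp add: node_order_def)

lemma nth_node_order: "j < size T \<Longrightarrow> node_order T \<sigma> \<tau> ! j = internal_node T \<sigma> (\<tau> (Suc j))"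
  by (simp add: node_order_def)

lemma bij_betw_internal_node:
  assumes "distinct_leaves (label_leaves T \<sigma>)"
  shows "bij_betw (internal_node T \<sigma>) {1..size T} (set (postorder_nodes (label_leaves T \<sigma>)))"
proof -
  let ?N = "postorder_nodes (label_leaves T \<sigma>)"
  have "bij_betw ((!) ?N) {..<size T} (set ?N)"
    by (rule bij_betw_nth)
      (simp_all add: distinct_postorder_nodes[OF assms] length_postorder_label_leaves)
  moreover have "bij_betw (\<lambda>k. k - 1) {1..size T} {..<size T}"
    by (rule bij_betw_byWitness[where f' = Suc]) auto
  ultimately have "bij_betw ((!) ?N \<circ> (\<lambda>k. k - 1)) {1..size T} (set ?N)"
    by (rule bij_betw_trans[rotated])
  then show ?thesis by (simp add: internal_node_def[abs_def] comp_def)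
qed

lemma ball_Suc_iff: "(\<forall>j\<in>{1..m}. P j) \<longleftrightarrow> (\<forall>j<m. P (Suc j))" for m :: nat
  unfolding image_Suc_lessThan[symmetric] by auto

lemma induces_linext_iff:
  assumes d: "distinct_leaves (label_leaves T \<sigma>)" and \<tau>: "\<tau> permutes {1..size T}"
  shows "set (node_order T \<sigma> \<tau>) = set (postorder_nodes (label_leaves T \<sigma>))"
    and "induces_linext T \<sigma> \<tau> \<longleftrightarrow> linear_extension (label_leaves T \<sigma>) (node_order T \<sigma> \<tau>)"
proof -
  let ?N = "set (postorder_nodes (label_leaves T \<sigma>))"
  have "bij_betw (internal_node T \<sigma> \<circ> \<tau>) {1..size T} ?N"
    using permutes_imp_bij[OF \<tau>] bij_betw_internal_node[OF d] by (rule bij_betw_trans)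
  moreover have "bij_betw Suc {..<size T} {1..size T}"
    by (rule bij_betw_byWitness[where f' = "\<lambda>k. k - 1"]) auto
  ultimately have bij: "bij_betw (internal_node T \<sigma> \<circ> \<tau> \<circ> Suc) {..<size T} ?N"
    by (rule bij_betw_trans[rotated])
  then show set: "set (node_order T \<sigma> \<tau>) = ?N"
    by (auto simp: node_order_def bij_betw_def comp_def atLeast0LessThan)
  have "distinct (node_order T \<sigma> \<tau>)"
    using bij by (simp add: node_order_def distinct_map bij_betw_def comp_def atLeast0LessThan)
  then show "induces_linext T \<sigma> \<tau> \<longleftrightarrow> linear_extension (label_leaves T \<sigma>) (node_order T \<sigma> \<tau>)"
    using set \<tau> unfolding induces_linext_def linear_extension_def children_first_def ball_Suc_iff
    by (auto simp: nth_node_order)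
qed

text \<open>Names the predicate under the description operator of \<open>tau\<close>, so that the
  latter can be folded.\<close>

definition is_tau :: "color tree \<Rightarrow> (nat \<Rightarrow> nat) \<Rightarrow> (nat \<Rightarrow> nat) \<Rightarrow> bool" where
  "is_tau T \<sigma> \<tau> \<longleftrightarrow> induces_linext T \<sigma> \<tau> \<and>
     (\<forall>j \<in> {1..size T}. \<forall>k \<in> {1..size T}. j < k \<longrightarrow>
        valency (internal_node T \<sigma> (\<tau> j)) \<ge> valency (internal_node T \<sigma> (\<tau> k)))"

lemma is_tau_iff:
  assumes d: "distinct_leaves (label_leaves T \<sigma>)"
  shows "is_tau T \<sigma> \<tau> \<longleftrightarrow> \<tau> permutes {1..size T} \<and> key_sorted (node_order T \<sigma> \<tau>)"
proof (cases "\<tau> permutes {1..size T}")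
  case True
  note I = induces_linext_iff[OF d True]
  have "is_tau T \<sigma> \<tau> \<longleftrightarrow> linear_extension (label_leaves T \<sigma>) (node_order T \<sigma> \<tau>) \<and>
      valency_decreasing (node_order T \<sigma> \<tau>)"
    unfolding is_tau_def I(2) ball_Suc_iff sorted_wrt_iff_nth_less
    by (auto simp: nth_node_order)
  then show ?thesis
    using True linear_extension_key_sorted[OF d] key_sorted_linear_extension[OF _ I(1)] by blast
qed (simp add: is_tau_def induces_linext_def)

text \<open>Different postorder positions carry different nodes, and outside
  \<open>{1..size T}\<close> both permutations are the identity.\<close>

lemma node_order_inj:
  assumes d: "distinct_leaves (label_leaves T \<sigma>)"
    and "\<tau> permutes {1..size T}" "\<tau>' permutes {1..size T}"
    and eq: "node_order T \<sigma> \<tau> = node_order T \<sigma> \<tau>'"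
  shows "\<tau> = \<tau>'"
proof
  fix j
  show "\<tau> j = \<tau>' j"
  proof (cases "j \<in> {1..size T}")
    case True
    then have "j - 1 < size T" "Suc (j - 1) = j" by auto
    then have "internal_node T \<sigma> (\<tau> j) = internal_node T \<sigma> (\<tau>' j)"
      using arg_cong[OF eq, of "\<lambda>l. l ! (j - 1)"] by (simp add: nth_node_order)
    then show ?thesis
      using inj_onD[OF bij_betw_imp_inj_on[OF bij_betw_internal_node[OF d]]]
        permutes_in_image[OF assms(2)] permutes_in_image[OF assms(3)] True by blast
  next
    case False
    then show ?thesis using assms(2,3) by (simp add: permutes_not_in)
  qed
qed

lemma ex_node_order:
  assumes d: "distinct_leaves (label_leaves T \<sigma>)"
    and xs: "distinct xs" "set xs = set (postorder_nodes (label_leaves T \<sigma>))"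
  obtains \<tau> where "\<tau> permutes {1..size T}" "node_order T \<sigma> \<tau> = xs"
proof -
  let ?N = "set (postorder_nodes (label_leaves T \<sigma>))" and ?I = "{1..size T}"
  note bij = bij_betw_internal_node[OF d]
  have len: "length xs = size T"
    using distinct_card[OF xs(1)] distinct_card[OF distinct_postorder_nodes[OF d]] xs(2)
    by (simp add: length_postorder_label_leaves)
  have "bij_betw ((!) xs) {..<size T} ?N"
    by (rule bij_betw_nth) (simp_all add: xs len)
  moreover have "bij_betw (\<lambda>k. k - 1) ?I {..<size T}"
    by (rule bij_betw_byWitness[where f' = Suc]) auto
  ultimately have "bij_betw ((!) xs \<circ> (\<lambda>k. k - 1)) ?I ?N" by (rule bij_betw_trans[rotated])
  then have b: "bij_betw (inv_into ?I (internal_node T \<sigma>) \<circ> ((!) xs \<circ> (\<lambda>k. k - 1))) ?I ?I"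
    using bij_betw_inv_into[OF bij] by (rule bij_betw_trans)
  define \<tau> where "\<tau> j = (if j \<in> ?I then inv_into ?I (internal_node T \<sigma>) (xs ! (j - 1)) else j)" for j
  have "bij_betw \<tau> ?I ?I"
    using b by (rule bij_betw_cong[THEN iffD1, rotated]) (simp add: \<tau>_def)
  then have "\<tau> permutes ?I" by (rule bij_imp_permutes) (auto simp: \<tau>_def)
  moreover have "node_order T \<sigma> \<tau> = xs"
  proof (rule nth_equalityI)
    fix j assume "j < length (node_order T \<sigma> \<tau>)"
    then have j: "j < size T" by simp
    have "xs ! j \<in> internal_node T \<sigma> ` ?I"
      using bij_betw_imp_surj_on[OF bij] xs(2) len j nth_mem by metis
    then show "node_order T \<sigma> \<tau> ! j = xs ! j"
      using j by (simp add: nth_node_order \<tau>_def f_inv_into_f)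
  qed (simp add: len)
  ultimately show ?thesis using that by blast
qed

text \<open>Resolves the description in \<open>tau\<close>: a permutation exists by
  \<open>ex_node_order\<close>, and it is unique because a key-sorted list is determined by its set
  and in turn determines the permutation.\<close>

lemma node_order_tau:
  assumes d: "distinct_leaves (label_leaves T \<sigma>)"
    and xs: "key_sorted xs" "set xs = set (postorder_nodes (label_leaves T \<sigma>))"
  shows "node_order T \<sigma> (tau T \<sigma>) = xs"
proof -
  have "distinct xs"
    using key_sorted_linear_extension(1)[OF xs] by (simp add: linear_extension_def)
  then obtain \<tau> where \<tau>: "\<tau> permutes {1..size T}" "node_order T \<sigma> \<tau> = xs"
    using ex_node_order[OF d] xs(2) by blast
  have "tau T \<sigma> = \<tau>"
    unfolding tau_def is_tau_def[symmetric]
  proof (rule the_equality)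
    show "is_tau T \<sigma> \<tau>" using is_tau_iff[OF d] \<tau> xs(1) by simp
    fix \<tau>' assume "is_tau T \<sigma> \<tau>'"
    then have \<tau>': "\<tau>' permutes {1..size T}" "key_sorted (node_order T \<sigma> \<tau>')"
      using is_tau_iff[OF d] by auto
    then have "node_order T \<sigma> \<tau>' = node_order T \<sigma> \<tau>"
      using key_sorted_unique[of "node_order T \<sigma> \<tau>'" xs] xs \<tau> induces_linext_iff(1)[OF d \<tau>'(1)]
      by simp
    then show "\<tau>' = \<tau>" using node_order_inj[OF d] \<tau>(1) \<tau>'(1) by blast
  qed
  then show ?thesis using \<tau> by simp
qed

lemma tree_chain_eq: "tree_chain T \<sigma> \<tau> = merge_chain (size1 T) (node_order T \<sigma> \<tau>)"
proof -
  have "chain_elem T \<sigma> \<tau> k = fold merge_at (take k (node_order T \<sigma> \<tau>)) (wp_bot (size1 T))"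
    if "k \<le> size T" for k
    using that by (induction k) (simp_all add: take_Suc_conv_app_nth nth_node_order)
  then show ?thesis by (simp add: tree_chain_def merge_chain_def size1_size)
qed

lemma wp_of_eq_wp_topD:
  assumes "builds n xs F" "wp_of F = wp_top n i"
  obtains t where "F = {t}" "num_red t = i"
proof -
  have inj: "inj_on leaf_labels F" by (rule inj_on_leaf_labels[OF builds_forest(2)[OF assms(1)]])
  have *: "leaf_labels s = {1..n} \<and> num_red s = i" if "s \<in> F" for s
    using assms(2) that by (auto simp: wp_of_def wp_top_def)
  have "F \<noteq> {}" using assms(2) by (auto simp: wp_of_def wp_top_def)
  then obtain t where "t \<in> F" by blast
  moreover have "s = t" if "s \<in> F" for s
    using inj_onD[OF inj, of s t] that \<open>t \<in> F\<close> * by simp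
  ultimately show ?thesis using that[of t] * by blast
qed

theorem theorem5p7:
  fixes n i :: nat
  assumes "n \<ge> 1" and "i \<le> n - 1"
  shows "{tree_chain T \<sigma> (tau T \<sigma>) | T \<sigma>. (T, \<sigma>) \<in> Lyn2 n i} =
         {c \<in> max_chains n (wp_bot n) (wp_top n i). ascent_free n c}"
proof (intro equalityI subsetI)
  fix c assume "c \<in> {tree_chain T \<sigma> (tau T \<sigma>) | T \<sigma>. (T, \<sigma>) \<in> Lyn2 n i}"
  then obtain T \<sigma> where c: "c = tree_chain T \<sigma> (tau T \<sigma>)" and "(T, \<sigma>) \<in> Lyn2 n i" by blast
  then have n: "size1 T = n" and i: "count_list (inorder T) Red = i"
    and \<sigma>: "\<sigma> permutes {1..n}" and lyn: "bicolored_lyndon (label_leaves T \<sigma>)"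
    by (auto simp: Lyn2_def BT_def)
  let ?t = "label_leaves T \<sigma>"
  have norm: "normalized ?t" using lyn by (simp add: bicolored_lyndon_def)
  have d: "distinct_leaves ?t"
    unfolding distinct_leaves_label_leaves n using \<sigma> by (rule permutes_inj_on)
  have lab: "leaf_labels ?t = {1..n}"
    unfolding leaf_labels_label_leaves n using \<sigma> by (rule permutes_image)
  obtain xs where xs: "key_sorted xs" "set xs = set (postorder_nodes ?t)"
    using ex_key_sorted[OF d] by blast
  note lin = key_sorted_linear_extension[OF xs]
  have b: "builds n xs {?t}" by (rule linear_extension_builds[OF norm d lab lin(1)])
  have c': "c = merge_chain n xs"
    unfolding c tree_chain_eq n node_order_tau[OF d xs] ..
  have "last c = wp_top n i"
    unfolding c' last_merge_chain builds_fold[OF b]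
    using lab i by (simp add: wp_of_def wp_top_def num_red_label_leaves)
  moreover have "c \<noteq> []" unfolding c' by (simp flip: length_greater_0_conv)
  moreover have "ascent_free n c"
    unfolding c' ascent_free_merge_chain[OF b] using lin(2) lyn by simp
  ultimately show "c \<in> {c \<in> max_chains n (wp_bot n) (wp_top n i). ascent_free n c}"
    using builds_successively[OF b] hd_merge_chain[of n xs]
    by (simp add: max_chains_def c')
next
  fix c assume "c \<in> {c \<in> max_chains n (wp_bot n) (wp_top n i). ascent_free n c}"
  then have c: "c \<noteq> []" "hd c = wp_bot n" "last c = wp_top n i" "successively (wp_covers n) c"
    and af: "ascent_free n c"
    by (auto simp: max_chains_def)
  obtain xs F where b: "builds n xs F" and cxs: "c = merge_chain n xs"
    using chain_ex_builds c by blast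
  have "wp_of F = wp_top n i" using c(3) builds_fold[OF b] by (simp add: cxs last_merge_chain)
  \<comment> \<open>The last partition has one block, and disjoint trees cannot share a leaf set, so
    one tree is left; the weight of the block counts its red nodes.\<close>
  then obtain t where F: "F = {t}" and i: "num_red t = i" by (rule wp_of_eq_wp_topD[OF b])
  have b': "builds n xs {t}" using b F by simp
  have d: "distinct_leaves t" and lab: "leaf_labels t = {1..n}"
    using builds_forest(1,3)[OF b'] by auto
  have dec: "valency_decreasing xs" and lyn: "bicolored_lyndon t"
    using af ascent_free_merge_chain[OF b'] by (auto simp: cxs)
  note lin = builds_linear_extension[OF b']
  have ks: "key_sorted xs" by (rule linear_extension_key_sorted[OF d lin dec])
  obtain T \<sigma> where T: "label_leaves T \<sigma> = t" "size1 T = n" "\<sigma> permutes {1..n}"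
    using ex_permutation_label_leaves[OF d lab] .
  have "node_order T \<sigma> (tau T \<sigma>) = xs"
    using node_order_tau[of T \<sigma> xs] d ks lin T(1) by (simp add: linear_extension_def)
  then have "c = tree_chain T \<sigma> (tau T \<sigma>)" by (simp add: cxs tree_chain_eq T(2))
  moreover have "(T, \<sigma>) \<in> Lyn2 n i"
    using T lyn i num_red_label_leaves[of T \<sigma>] by (auto simp: Lyn2_def BT_def)
  ultimately show "c \<in> {tree_chain T \<sigma> (tau T \<sigma>) | T \<sigma>. (T, \<sigma>) \<in> Lyn2 n i}" by blast
qed

end
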